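(* Let $\varphi:\mathbb{D}\to\mathbb{D}$ be a holomorphic function with a fixed point in $\mathbb{D}$ and consider $C_\varphi\in\mathcal{L}(H^p)$, $1<p<\infty$. Then there exist non-trivial idempotents lying in $\{C_\varphi\}''$. As a matter of fact, $C_\varphi$ has neither the functional commutant property nor the functional bicommutant property.
   Context: $\mathbb{D}$ is the open unit disc of $\mathbb{C}$. For $1\le p<\infty$, $H^p$ is the Banach space of holomorphic $f:\mathbb{D}\to\mathbb{C}$ with $\|f\|_{H^p}=\left(\sup_{0<r<1}\int_0^{2\pi}|f(re^{i\theta})|^p\,d\theta\right)^{1/p}<\infty$. For holomorphic $\varphi:\mathbb{D}\to\mathbb{D}$, $C_\varphi f=f\circ\varphi$, a bounded operator on $H^p$. For a complex Banach space $X$, $\mathcal{L}(X)$ is the algebra of bounded linear operators on $X$. For $T\in\mathcal{L}(X)$, $\{T\}'=\{A\in\mathcal{L}(X):AT=TA\}$ and $\{T\}''=\bigcap_{A\in\{T\}'}\{A\}'$. A non-trivial idempotent is $J\in\mathcal{L}(X)$ with $J^2=J$, $J\ne 0$, $J\neq \mathrm{Id}_X$. For $G\subset\mathbb{C}$, $\mathcal{C}(G)$ is the algebra of all continuous functions $f:G\to\mathbb{C}$ with pointwise operations (no topology is considered). $T$ has the functional commutant property (respectively, functional bicommutant property) if there exist a connected subset $G\subset\mathbb{C}$, a subalgebra $\mathcal{A}\subseteq\mathcal{C}(G)$ and an algebra isomorphism $\Phi:\mathcal{A}\to\{T\}'$ (respectively, $\Phi:\mathcal{A}\to\{T\}''$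).
   Formalization: For φ the identity, {C_φ}'' consists of scalars, so the claims on idempotents in {C_φ}'' and on the functional bicommutant property fail; these two are stated for φ different from the identity, while failure of the functional commutant property is stated for all φ. *)

theory Defs
  imports "HOL-Complex_Analysis.Complex_Analysis" "HOL-Library.Function_Algebras"
begin

text \<open>
  Functions on a proper subset of a type are represented by their extension by zero to the whole
  type. This applies to functions on the unit disc, to functions on a subset \<open>G\<close> of the plane, and
  to operators on a space \<open>X\<close>. Every such function has exactly one representative, and the
  vector space operations, the pointwise product and (for linear operators) the composition are
  the plain ones on the type.
\<close>

abbreviation unit_disc :: "complex set" where
  "unit_disc \<equiv> ball 0 1"

definition hardy_mean :: "real \<Rightarrow> (complex \<Rightarrow> complex) \<Rightarrow> real \<Rightarrow> real" where
  "hardy_mean p f r = integral {0..2 * pi} (\<lambda>\<theta>. norm (f (of_real r * cis \<theta>)) powr p)"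

definition hardy_space :: "real \<Rightarrow> (complex \<Rightarrow> complex) set" where
  "hardy_space p =
     {f. f holomorphic_on unit_disc \<and> (\<forall>z. z \<notin> unit_disc \<longrightarrow> f z = 0) \<and>
         bdd_above (hardy_mean p f ` {0<..<1})}"

definition hardy_norm :: "real \<Rightarrow> (complex \<Rightarrow> complex) \<Rightarrow> real" where
  "hardy_norm p f = (SUP r\<in>{0<..<1}. hardy_mean p f r) powr (1 / p)"

text \<open>
  In the following, \<open>X\<close> is (the carrier of) a complex Banach space whose elements are
  complex-valued functions with the pointwise operations, and \<open>N\<close> is its norm.
\<close>

definition bounded_operators ::
  "('s \<Rightarrow> complex) set \<Rightarrow> (('s \<Rightarrow> complex) \<Rightarrow> real) \<Rightarrow> (('s \<Rightarrow> complex) \<Rightarrow> ('s \<Rightarrow> complex)) set" where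
  "bounded_operators X N =
     {T. (\<forall>f\<in>X. T f \<in> X) \<and> (\<forall>f. f \<notin> X \<longrightarrow> T f = 0) \<and>
         (\<forall>f\<in>X. \<forall>g\<in>X. T (f + g) = T f + T g) \<and>
         (\<forall>c. \<forall>f\<in>X. T (\<lambda>x. c * f x) = (\<lambda>x. c * T f x)) \<and>
         (\<exists>K. \<forall>f\<in>X. N (T f) \<le> K * N f)}"

definition identity_operator ::
  "('s \<Rightarrow> complex) set \<Rightarrow> ('s \<Rightarrow> complex) \<Rightarrow> ('s \<Rightarrow> complex)" where
  "identity_operator X f = (if f \<in> X then f else 0)"

definition commutant ::
  "('s \<Rightarrow> complex) set \<Rightarrow> (('s \<Rightarrow> complex) \<Rightarrow> real) \<Rightarrow> (('s \<Rightarrow> complex) \<Rightarrow> ('s \<Rightarrow> complex)) \<Rightarrow>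
     (('s \<Rightarrow> complex) \<Rightarrow> ('s \<Rightarrow> complex)) set" where
  "commutant X N T = {A \<in> bounded_operators X N. A \<circ> T = T \<circ> A}"

definition bicommutant ::
  "('s \<Rightarrow> complex) set \<Rightarrow> (('s \<Rightarrow> complex) \<Rightarrow> real) \<Rightarrow> (('s \<Rightarrow> complex) \<Rightarrow> ('s \<Rightarrow> complex)) \<Rightarrow>
     (('s \<Rightarrow> complex) \<Rightarrow> ('s \<Rightarrow> complex)) set" where
  "bicommutant X N T = (\<Inter>A\<in>commutant X N T. commutant X N A)"

definition nontrivial_idempotent ::
  "('s \<Rightarrow> complex) set \<Rightarrow> (('s \<Rightarrow> complex) \<Rightarrow> real) \<Rightarrow> (('s \<Rightarrow> complex) \<Rightarrow> ('s \<Rightarrow> complex)) \<Rightarrow> bool" where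
  "nontrivial_idempotent X N J \<longleftrightarrow>
     J \<in> bounded_operators X N \<and> J \<circ> J = J \<and> J \<noteq> 0 \<and> J \<noteq> identity_operator X"

definition continuous_functions :: "complex set \<Rightarrow> (complex \<Rightarrow> complex) set" where
  "continuous_functions G = {f. continuous_on G f \<and> (\<forall>z. z \<notin> G \<longrightarrow> f z = 0)}"

text \<open>Subalgebras are not required to contain the constant function 1.\<close>

definition subalgebra_of_continuous :: "complex set \<Rightarrow> (complex \<Rightarrow> complex) set \<Rightarrow> bool" where
  "subalgebra_of_continuous G \<A> \<longleftrightarrow>
     \<A> \<subseteq> continuous_functions G \<and> 0 \<in> \<A> \<and>
     (\<forall>f\<in>\<A>. \<forall>g\<in>\<A>. f + g \<in> \<A>) \<and>
     (\<forall>c. \<forall>f\<in>\<A>. (\<lambda>z. c * f z) \<in> \<A>) \<and>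
     (\<forall>f\<in>\<A>. \<forall>g\<in>\<A>. f * g \<in> \<A>)"

definition algebra_isomorphism ::
  "(complex \<Rightarrow> complex) set \<Rightarrow> (('s \<Rightarrow> complex) \<Rightarrow> ('s \<Rightarrow> complex)) set \<Rightarrow>
     ((complex \<Rightarrow> complex) \<Rightarrow> (('s \<Rightarrow> complex) \<Rightarrow> ('s \<Rightarrow> complex))) \<Rightarrow> bool" where
  "algebra_isomorphism \<A> \<B> \<Phi> \<longleftrightarrow>
     bij_betw \<Phi> \<A> \<B> \<and>
     (\<forall>f\<in>\<A>. \<forall>g\<in>\<A>. \<Phi> (f + g) = \<Phi> f + \<Phi> g) \<and>
     (\<forall>c. \<forall>f\<in>\<A>. \<Phi> (\<lambda>z. c * f z) = (\<lambda>h x. c * \<Phi> f h x)) \<and>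
     (\<forall>f\<in>\<A>. \<forall>g\<in>\<A>. \<Phi> (f * g) = \<Phi> f \<circ> \<Phi> g)"

definition functional_commutant_property ::
  "('s \<Rightarrow> complex) set \<Rightarrow> (('s \<Rightarrow> complex) \<Rightarrow> real) \<Rightarrow> (('s \<Rightarrow> complex) \<Rightarrow> ('s \<Rightarrow> complex)) \<Rightarrow> bool" where
  "functional_commutant_property X N T \<longleftrightarrow>
     (\<exists>G \<A> \<Phi>. connected G \<and> subalgebra_of_continuous G \<A> \<and>
        algebra_isomorphism \<A> (commutant X N T) \<Phi>)"

definition functional_bicommutant_property ::
  "('s \<Rightarrow> complex) set \<Rightarrow> (('s \<Rightarrow> complex) \<Rightarrow> real) \<Rightarrow> (('s \<Rightarrow> complex) \<Rightarrow> ('s \<Rightarrow> complex)) \<Rightarrow> bool" where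
  "functional_bicommutant_property X N T \<longleftrightarrow>
     (\<exists>G \<A> \<Phi>. connected G \<and> subalgebra_of_continuous G \<A> \<and>
        algebra_isomorphism \<A> (bicommutant X N T) \<Phi>)"

definition composition_operator ::
  "real \<Rightarrow> (complex \<Rightarrow> complex) \<Rightarrow> (complex \<Rightarrow> complex) \<Rightarrow> (complex \<Rightarrow> complex)" where
  "composition_operator p \<phi> f =
     (if f \<in> hardy_space p then (\<lambda>z. if z \<in> unit_disc then f (\<phi> z) else 0) else 0)"

end

theory Submission
  imports Defs
begin

text \<open>
  Let \<open>T\<close> be the operator of composition with \<open>\<phi>\<close>, and let \<open>\<phi> a = a\<close>. If \<open>\<phi>\<close> is not the identity, the
  idempotent is the mean ergodic projection, \<open>J f = lim (f + T f + \<dots> + T\<^sup>n\<^sup>-\<^sup>1 f) / n\<close>. Being a strong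
  limit of polynomials in \<open>T\<close>, it commutes with every operator that commutes with \<open>T\<close>. Its range
  consists of fixed points of \<open>T\<close>, and it fixes each of them, in particular the constants. So \<open>J \<noteq> 0\<close>,
  and \<open>J = I\<close> would make every function a fixed point of \<open>T\<close>, also the function \<open>z\<close>, whence \<open>\<phi> = id\<close>.
  For instance, \<open>J f\<close> is the constant \<open>f a\<close> if the iterates of \<open>\<phi>\<close> converge to \<open>a\<close>, and an average over
  a finite group of rotations if \<open>\<phi>\<close> is conjugate to a rotation of finite order. The ergodic means
  cover all these cases together, without any study of the dynamics of \<open>\<phi>\<close>.

  The means converge by an argument of Birkhoff for contractions of uniformly convex spaces
  (\<open>ergodic_means_Cauchy\<close>). Two facts about \<open>H\<^sup>p\<close> make it applicable. First, \<open>H\<^sup>p\<close> is uniformly convex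
  for \<open>1 < p\<close>: there is a pointwise inequality between \<open>\<bar>a - b\<bar>\<^sup>p\<close>, \<open>\<bar>a\<bar>\<^sup>p + \<bar>b\<bar>\<^sup>p\<close> and the convexity defect
  of \<open>\<bar>\<cdot>\<bar>\<^sup>p\<close> at the midpoint (\<open>norm_powr_uniformly_convex\<close>), and it can be integrated over circles.
  Second, by Littlewood's subordination principle (\<open>hardy_sup_compose\<close>), \<open>T\<close> does not increase the
  norm if \<open>a = 0\<close>. For general \<open>a\<close> the same holds for the equivalent norm \<open>\<parallel>f \<circ> g\<parallel>\<close>, where \<open>g\<close> is an
  automorphism of the disc with \<open>g 0 = a\<close>, because \<open>g\<^sup>-\<^sup>1 \<circ> \<phi> \<circ> g\<close> fixes \<open>0\<close>. The subordination principle
  rests on the Poisson kernel, and it also yields the monotonicity of the circle means and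
  the continuity of point evaluations.

  Norms enter through their \<open>p\<close>-th powers. These are convex functionals, and convexity takes the place
  of Minkowski's inequality throughout.

  An algebra isomorphism turns idempotents into idempotent continuous functions. On a connected set
  these are constant, so they correspond to \<open>0\<close> and \<open>I\<close>. This excludes both functional properties as soon as
  the algebra contains \<open>J\<close>. If \<open>\<phi>\<close> is the identity, the commutant consists of all bounded operators,
  which do not commute with each other.
\<close>

section \<open>Convexity of powers of the modulus\<close>

text \<open>
  All convexity below is derived from this form, because tangent lines can be integrated. The mean
  value theorem gives a slope \<open>p \<xi> powr (p - 1)\<close> with \<open>\<xi>\<close> strictly between the two points; working with
  the tangent at \<open>y > 0\<close> allows \<open>x = 0\<close>.
\<close>

lemma powr_above_tangent_strict:
  fixes x y p :: real
  assumes "1 < p" "0 \<le> x" "0 < y" "x \<noteq> y"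
  shows "y powr p + p * y powr (p - 1) * (x - y) < x powr p"
proof -
  have cont: "continuous_on A (\<lambda>x::real. x powr p)" if "A \<subseteq> {0..}" for A
    using \<open>1 < p\<close> that by (intro continuous_on_powr' continuous_intros) auto
  have der: "((\<lambda>x. x powr p) has_real_derivative p * u powr (p - 1)) (at u)" if "u > 0" for u :: real
    using that by (rule has_real_derivative_powr)
  then have diff: "(\<lambda>x. x powr p) differentiable (at u)" if "u > 0" for u :: real
    using that real_differentiable_def by blast
  show ?thesis
  proof (cases "x < y")
    case True
    obtain l z where z: "x < z" "z < y" "((\<lambda>x. x powr p) has_real_derivative l) (at z)"
        "y powr p - x powr p = (y - x) * l"
      using MVT[OF True, of "\<lambda>x. x powr p"] cont[of "{x..y}"] diff \<open>0 \<le> x\<close> by force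
    have "l = p * z powr (p - 1)"
      using z der[of z] \<open>0 \<le> x\<close> DERIV_unique by force
    moreover have "z powr (p - 1) < y powr (p - 1)"
      using z \<open>0 \<le> x\<close> \<open>1 < p\<close> by (intro powr_less_mono2) auto
    ultimately have "l < p * y powr (p - 1)" using \<open>1 < p\<close> by auto
    then have "(y - x) * l < (y - x) * (p * y powr (p - 1))" using True by auto
    then show ?thesis using z(4) by (simp add: algebra_simps)
  next
    case False
    then have "y < x" using assms by auto
    obtain l z where z: "y < z" "z < x" "((\<lambda>x. x powr p) has_real_derivative l) (at z)"
        "x powr p - y powr p = (x - y) * l"
      using MVT[OF \<open>y < x\<close>, of "\<lambda>x. x powr p"] cont[of "{y..x}"] diff \<open>0 < y\<close> by force
    have "l = p * z powr (p - 1)"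
      using z der[of z] \<open>0 < y\<close> DERIV_unique by force
    moreover have "y powr (p - 1) < z powr (p - 1)"
      using z \<open>0 < y\<close> \<open>1 < p\<close> by (intro powr_less_mono2) auto
    ultimately have "p * y powr (p - 1) < l" using \<open>1 < p\<close> by auto
    then have "(x - y) * (p * y powr (p - 1)) < (x - y) * l" using \<open>y < x\<close> by auto
    then show ?thesis using z(4) by (simp add: algebra_simps)
  qed
qed

lemma powr_above_tangent:
  fixes x y p :: real
  assumes "1 < p" "0 \<le> x" "0 < y"
  shows "y powr p + p * y powr (p - 1) * (x - y) \<le> x powr p"
  using powr_above_tangent_strict[OF assms] by (cases "x = y") auto

lemma powr_convex_combination:
  fixes x y t p :: real
  assumes "1 < p" "0 \<le> x" "0 \<le> y" "0 \<le> t" "t \<le> 1"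
  shows "((1 - t) * x + t * y) powr p \<le> (1 - t) * x powr p + t * y powr p"
proof -
  define m where "m = (1 - t) * x + t * y"
  have "0 \<le> m" using assms by (simp add: m_def)
  show ?thesis
  proof (cases "m = 0")
    case True
    then show ?thesis using assms by (simp add: m_def)
  next
    case False
    then have "0 < m" using \<open>0 \<le> m\<close> by simp
    define c where "c = p * m powr (p - 1)"
    have "m powr p = (1 - t) * (m powr p + c * (x - m)) + t * (m powr p + c * (y - m))"
      by (simp add: m_def algebra_simps)
    also have "\<dots> \<le> (1 - t) * x powr p + t * y powr p"
      unfolding c_def using assms \<open>0 < m\<close>
      by (intro add_mono mult_left_mono powr_above_tangent) auto
    finally show ?thesis by (simp add: m_def)
  qed
qed

lemma powr_midpoint_less:
  fixes x y p :: real
  assumes "1 < p" "0 \<le> x" "0 \<le> y" "x \<noteq> y"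
  shows "((x + y) / 2) powr p < (x powr p + y powr p) / 2"
proof -
  define m where "m = (x + y) / 2"
  have "0 < m" "x \<noteq> m" using assms by (auto simp: m_def)
  define c where "c = p * m powr (p - 1)"
  have "m powr p + c * (x - m) < x powr p"
    unfolding c_def using assms \<open>0 < m\<close> \<open>x \<noteq> m\<close> by (intro powr_above_tangent_strict)
  moreover have "m powr p + c * (y - m) \<le> y powr p"
    unfolding c_def using assms \<open>0 < m\<close> by (intro powr_above_tangent)
  moreover have "c * (x - m) + c * (y - m) = 0"
    by (simp add: m_def algebra_simps)
  ultimately show ?thesis by (simp add: m_def)
qed

lemma norm_powr_convex_combination:
  fixes a b :: complex
  assumes "1 < p" "0 \<le> t" "t \<le> 1"
  shows "norm (of_real (1 - t) * a + of_real t * b) powr p \<le> (1 - t) * norm a powr p + t * norm b powr p"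
proof -
  have "norm (of_real (1 - t) * a + of_real t * b) \<le> (1 - t) * norm a + t * norm b"
    using norm_triangle_ineq[of "of_real (1 - t) * a" "of_real t * b"] assms
    by (simp add: norm_mult del: of_real_diff)
  then have "norm (of_real (1 - t) * a + of_real t * b) powr p \<le> ((1 - t) * norm a + t * norm b) powr p"
    using assms by (intro powr_mono2) auto
  also have "\<dots> \<le> (1 - t) * norm a powr p + t * norm b powr p"
    using assms by (intro powr_convex_combination) auto
  finally show ?thesis .
qed

text \<open>
  If the moduli differ, strict convexity of the power decides; if they agree, it is the strict triangle
  inequality of the Euclidean norm.
\<close>

lemma norm_powr_midpoint_less:
  fixes a b :: complex
  assumes "1 < p" "a \<noteq> b"
  shows "norm ((a + b) / 2) powr p < (norm a powr p + norm b powr p) / 2"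
proof (cases "norm a = norm b")
  case True
  have "norm (a + b) \<noteq> norm a + norm b"
    using assms True unfolding norm_triangle_eq by auto
  then have "norm (a + b) < norm a + norm b"
    using norm_triangle_ineq[of a b] by linarith
  then have "norm ((a + b) / 2) < norm a" using True by (simp add: norm_divide)
  then have "norm ((a + b) / 2) powr p < norm a powr p"
    using assms by (intro powr_less_mono2) auto
  then show ?thesis using True by simp
next
  case False
  have "norm ((a + b) / 2) \<le> (norm a + norm b) / 2"
    using norm_triangle_ineq[of a b] by (simp add: norm_divide)
  then have "norm ((a + b) / 2) powr p \<le> ((norm a + norm b) / 2) powr p"
    using assms by (intro powr_mono2) auto
  also have "\<dots> < (norm a powr p + norm b powr p) / 2"
    using assms False by (intro powr_midpoint_less) auto
  finally show ?thesis .
qed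

lemma norm_powr_add_le:
  fixes a b :: complex
  assumes "1 < p"
  shows "norm (a + b) powr p \<le> 2 powr p * (norm a powr p + norm b powr p)"
proof -
  have "norm (a + b) \<le> 2 * max (norm a) (norm b)"
    using norm_triangle_ineq[of a b] by linarith
  then have "norm (a + b) powr p \<le> (2 * max (norm a) (norm b)) powr p"
    using assms by (intro powr_mono2) auto
  also have "\<dots> = 2 powr p * max (norm a) (norm b) powr p"
    by (simp add: powr_mult)
  also have "\<dots> \<le> 2 powr p * (norm a powr p + norm b powr p)"
    by (intro mult_left_mono) (auto simp: max_def)
  finally show ?thesis .
qed

text \<open>
  Uniform convexity of \<open>L\<^sup>p\<close> in a form that survives integration. Both sides are homogeneous of
  degree \<open>p\<close>, so it suffices to consider the unit sphere of \<open>\<complex>\<^sup>2\<close>. Where the left side exceeds the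
  \<open>\<epsilon>\<close>-term we have \<open>a \<noteq> b\<close>, so that the convexity defect is positive there, and by compactness it is
  bounded below.
\<close>

lemma norm_powr_uniformly_convex:
  assumes "1 < p" "0 < \<epsilon>"
  obtains C :: real where "0 \<le> C"
    "\<And>a b :: complex. norm (a - b) powr p
        \<le> \<epsilon> * (norm a powr p + norm b powr p)
          + C * ((norm a powr p + norm b powr p) / 2 - norm ((a + b) / 2) powr p)"
proof -
  define D where "D = (\<lambda>x::complex \<times> complex.
     (norm (fst x) powr p + norm (snd x) powr p) / 2 - norm ((fst x + snd x) / 2) powr p)"
  define G where "G = (\<lambda>x::complex \<times> complex.
     norm (fst x - snd x) powr p - \<epsilon> * (norm (fst x) powr p + norm (snd x) powr p))"
  have contD: "continuous_on A D" and contG: "continuous_on A G" for A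
    unfolding D_def G_def using \<open>1 < p\<close> by (auto intro!: continuous_intros continuous_on_powr')
  have D_pos: "0 < D x" if "fst x \<noteq> snd x" for x
    using norm_powr_midpoint_less[OF \<open>1 < p\<close> that] by (simp add: D_def)
  have D_nonneg: "0 \<le> D x" for x
  proof (cases "fst x = snd x")
    case True
    then show ?thesis by (simp add: D_def)
  qed (use D_pos in \<open>auto simp: less_imp_le\<close>)
  \<comment> \<open>The part of the sphere on which the \<open>\<epsilon>\<close>-term alone is not sufficient.\<close>
  define Z where "Z = sphere 0 1 \<inter> {x. 0 \<le> G x}"
  have "compact Z" unfolding Z_def
    by (intro compact_Int_closed closed_Collect_le) (auto intro!: continuous_intros contG)
  have "\<exists>C\<ge>0. \<forall>x\<in>sphere 0 1. G x \<le> C * D x"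
  proof (cases "Z = {}")
    case True
    then show ?thesis by (intro exI[of _ 0]) (force simp: Z_def)
  next
    case False
    have Dz: "0 < D x" if "x \<in> Z" for x
    proof (rule D_pos, rule notI)
      assume eq: "fst x = snd x"
      have "fst x \<noteq> 0" using that eq by (cases x) (auto simp: Z_def norm_Pair)
      then have "0 < norm (fst x) powr p + norm (snd x) powr p" by (simp add: eq)
      then have "G x < 0" unfolding G_def using eq \<open>0 < \<epsilon>\<close> \<open>1 < p\<close> by (simp add: zero_less_mult_iff)
      then show False using that by (simp add: Z_def)
    qed
    obtain x0 where x0: "x0 \<in> Z" "\<And>x. x \<in> Z \<Longrightarrow> D x0 \<le> D x"
      using continuous_attains_inf[OF \<open>compact Z\<close> False contD] by blast
    obtain x1 where x1: "x1 \<in> Z" "\<And>x. x \<in> Z \<Longrightarrow> G x \<le> G x1"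
      using continuous_attains_sup[OF \<open>compact Z\<close> False contG] by blast
    have "0 \<le> G x1" using x1(1) by (simp add: Z_def)
    show ?thesis
    proof (intro exI[of _ "G x1 / D x0"] conjI ballI)
      show "0 \<le> G x1 / D x0" using \<open>0 \<le> G x1\<close> Dz[OF x0(1)] by simp
      fix x :: "complex \<times> complex" assume x: "x \<in> sphere 0 1"
      show "G x \<le> G x1 / D x0 * D x"
      proof (cases "0 \<le> G x")
        case True
        then have "x \<in> Z" using x by (simp add: Z_def)
        have "G x \<le> G x1 * (D x / D x0)"
          using x1(2)[OF \<open>x \<in> Z\<close>] x0(2)[OF \<open>x \<in> Z\<close>] Dz[OF x0(1)] \<open>0 \<le> G x1\<close>
          by (smt (verit) le_divide_eq_1_pos mult_left_le mult_le_cancel_left1 mult_left_mono)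
        then show ?thesis by simp
      next
        case False
        then show ?thesis
          using \<open>0 \<le> G x1 / D x0\<close> D_nonneg[of x] by (meson linear mult_nonneg_nonneg order_trans)
      qed
    qed
  qed
  then obtain C where C: "0 \<le> C" "\<And>x. x \<in> sphere 0 1 \<Longrightarrow> G x \<le> C * D x" by blast
  have "G x \<le> C * D x" for x
  proof (cases "x = 0")
    case True
    then show ?thesis by (simp add: G_def D_def)
  next
    case False
    define s where "s = norm x"
    have "0 < s" using False by (simp add: s_def)
    define y where "y = (1 / s) *\<^sub>R x"
    have x: "x = s *\<^sub>R y" using \<open>0 < s\<close> by (simp add: y_def)
    have hom: "norm (s *\<^sub>R u) powr p = s powr p * norm u powr p" for u :: complex
      using \<open>0 < s\<close> by (simp add: powr_mult)
    have "G x = s powr p * G y"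
      unfolding x G_def fst_scaleR snd_scaleR scaleR_diff_right[symmetric] hom
      by (simp add: algebra_simps)
    moreover have "(s *\<^sub>R fst y + s *\<^sub>R snd y) / 2 = s *\<^sub>R ((fst y + snd y) / 2)"
      by (simp add: scaleR_conv_of_real algebra_simps)
    then have "D x = s powr p * D y"
      unfolding x D_def fst_scaleR snd_scaleR using hom
      by (simp only:) (simp add: field_simps)
    moreover have "G y \<le> C * D y" using False by (intro C(2)) (simp add: y_def s_def)
    then have "s powr p * G y \<le> s powr p * (C * D y)" by (intro mult_left_mono) auto
    ultimately show ?thesis by (simp add: mult_ac)
  qed
  then have "norm (a - b) powr p - \<epsilon> * (norm a powr p + norm b powr p)
      \<le> C * ((norm a powr p + norm b powr p) / 2 - norm ((a + b) / 2) powr p)" for a b :: complex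
    unfolding G_def D_def using fst_conv snd_conv by metis
  with \<open>0 \<le> C\<close> show ?thesis
    by (intro that[of C]) (simp_all only: diff_le_eq add.commute)
qed

section \<open>The Poisson kernel\<close>

lemma Cauchy_formula_circle:
  assumes "g holomorphic_on cball 0 r" "norm z < r"
  shows "((\<lambda>t. g (of_real r * cis t) * (of_real r * cis t) / (of_real r * cis t - z))
           has_integral 2 * of_real pi * g z) {0..2 * pi}"
proof -
  have "((\<lambda>u. g u / (u - z)) has_contour_integral (2 * of_real pi * \<i> * g z)) (part_circlepath 0 r 0 (2 * pi))"
    using Cauchy_integral_circlepath_simple[of g 0 r z] assms by (simp add: circlepath_def)
  then have "((\<lambda>t. g (of_real r * cis t) / (of_real r * cis t - z) * of_real r * \<i> * cis t)
           has_integral 2 * of_real pi * \<i> * g z) {0..2 * pi}"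
    by (subst (asm) has_contour_integral_part_circlepath_iff) auto
  from has_integral_mult_right[OF this, of "-\<i>"] show ?thesis
    by (simp add: algebra_simps)
qed

text \<open>
  Normalised to have mean value 1: the integral over \<open>{0..2 * pi}\<close> is \<open>2 * pi\<close>.
\<close>

definition Poisson_kernel :: "real \<Rightarrow> real \<Rightarrow> complex \<Rightarrow> real" where
  "Poisson_kernel r t z = (r\<^sup>2 - (norm z)\<^sup>2) / (norm (of_real r * cis t - z))\<^sup>2"

lemma circle_point_neq: "norm z < r \<Longrightarrow> complex_of_real r * cis t \<noteq> z"
  by (auto simp: norm_mult)

lemma Poisson_kernel_nonneg: "norm z < r \<Longrightarrow> 0 \<le> Poisson_kernel r t z"
  unfolding Poisson_kernel_def by (intro divide_nonneg_nonneg) (auto intro: power_mono)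

lemma Poisson_kernel_le:
  assumes "norm z < r"
  shows "Poisson_kernel r t z \<le> (r + norm z) / (r - norm z)"
proof -
  have "r - norm z \<le> norm (of_real r * cis t - z)"
    using norm_triangle_ineq2[of "of_real r * cis t" z] assms by (simp add: norm_mult)
  then have "(r - norm z)\<^sup>2 \<le> (norm (of_real r * cis t - z))\<^sup>2"
    using assms by (intro power_mono) auto
  moreover have "0 < r - norm z" "0 \<le> r\<^sup>2 - (norm z)\<^sup>2" using assms by (auto intro: power_mono)
  ultimately have "Poisson_kernel r t z \<le> (r\<^sup>2 - (norm z)\<^sup>2) / (r - norm z)\<^sup>2"
    unfolding Poisson_kernel_def using \<open>r - norm z \<le> norm (of_real r * cis t - z)\<close>
    by (intro divide_left_mono mult_pos_pos zero_less_power) auto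
  also have "r\<^sup>2 - (norm z)\<^sup>2 = (r + norm z) * (r - norm z)"
    by (simp add: power2_eq_square algebra_simps)
  also have "\<dots> / (r - norm z)\<^sup>2 = (r + norm z) / (r - norm z)"
    using \<open>0 < r - norm z\<close> by (simp add: power2_eq_square)
  finally show ?thesis .
qed

lemma continuous_on_Poisson_kernel:
  assumes "continuous_on A a" "continuous_on A b" "\<And>x. x \<in> A \<Longrightarrow> norm (b x) < r"
  shows "continuous_on A (\<lambda>x. Poisson_kernel r (a x) (b x))"
  unfolding Poisson_kernel_def using assms circle_point_neq
  by (intro continuous_intros) auto

lemma Poisson_kernel_eq_Re:
  assumes "norm z < r"
  shows "Poisson_kernel r t z = Re ((of_real r * cis t + z) / (of_real r * cis t - z))"
proof -
  define w where "w = of_real r * cis t"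
  have "0 < r" using assms norm_ge_zero order_le_less_trans by blast
  then have "norm w = r" "w \<noteq> z" using circle_point_neq[OF assms, of t] by (auto simp: w_def norm_mult)
  have "Re ((w + z) / (w - z)) = Re ((w + z) * cnj (w - z)) / (norm (w - z))\<^sup>2"
    by (simp add: complex_div_cnj[of "w + z"] Re_divide_of_real flip: of_real_power)
  also have "Re ((w + z) * cnj (w - z)) = (norm w)\<^sup>2 - (norm z)\<^sup>2"
    by (simp only: cmod_power2) (simp add: algebra_simps power2_eq_square)
  finally show ?thesis using \<open>norm w = r\<close> by (simp add: Poisson_kernel_def w_def)
qed

text \<open>
  Cauchy's formula for \<open>u \<mapsto> f u (r\<^sup>2 - \<bar>z\<bar>\<^sup>2) / (r\<^sup>2 - cnj z u)\<close>, a holomorphic function whose value at \<open>z\<close>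
  is \<open>f z\<close>: on the circle \<open>w cnj w = r\<^sup>2\<close>, and the extra factor turns the Cauchy kernel into the Poisson kernel.
\<close>

lemma Poisson_formula:
  assumes f: "f holomorphic_on cball 0 r" and z: "norm z < r"
  shows "((\<lambda>t. of_real (Poisson_kernel r t z) * f (of_real r * cis t)) has_integral
           2 * of_real pi * f z) {0..2 * pi}"
proof -
  have "0 < r" using z norm_ge_zero order_le_less_trans by blast
  define c :: complex where "c = of_real (r\<^sup>2 - (norm z)\<^sup>2)"
  have nz: "of_real r ^ 2 - cnj z * u \<noteq> 0" if "u \<in> cball 0 r" for u
  proof
    assume "of_real r ^ 2 - cnj z * u = 0"
    then have "norm (of_real r ^ 2 :: complex) = norm (cnj z * u)" by simp
    then have "r * r = norm z * norm u" by (simp add: norm_mult norm_power power2_eq_square)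
    also have "\<dots> \<le> norm z * r" using that by (intro mult_left_mono) auto
    also have "\<dots> < r * r" using z \<open>0 < r\<close> by (intro mult_strict_right_mono)
    finally show False by simp
  qed
  have c: "c = of_real r ^ 2 - cnj z * z"
    using complex_norm_square[of z] by (simp add: c_def mult.commute)
  have "c \<noteq> 0" unfolding c using nz[of z] z by simp
  have "(\<lambda>u. f u * c / (of_real r ^ 2 - cnj z * u)) holomorphic_on cball 0 r"
    using nz by (intro holomorphic_intros f) auto
  from Cauchy_formula_circle[OF this z]
  have *: "((\<lambda>t. f (of_real r * cis t) * c / (of_real r ^ 2 - cnj z * (of_real r * cis t)) *
            (of_real r * cis t) / (of_real r * cis t - z)) has_integral 2 * of_real pi * f z) {0..2 * pi}"
    using \<open>c \<noteq> 0\<close> by (simp add: c[symmetric])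
  have "f (of_real r * cis t) * c / (of_real r ^ 2 - cnj z * (of_real r * cis t)) *
            (of_real r * cis t) / (of_real r * cis t - z)
        = of_real (Poisson_kernel r t z) * f (of_real r * cis t)" for t
  proof -
    define w where "w = of_real r * cis t"
    have w: "w \<noteq> z" "norm w = r" using circle_point_neq[OF z] \<open>0 < r\<close> by (auto simp: w_def norm_mult)
    have "of_real r ^ 2 = w * cnj w"
      using w(2) complex_norm_square[of w] by simp
    then have "of_real r ^ 2 - cnj z * w = w * cnj (w - z)" by (simp add: algebra_simps)
    then have "f w * c / (of_real r ^ 2 - cnj z * w) * w / (w - z) = f w * c / ((w - z) * cnj (w - z))"
      using w \<open>0 < r\<close> by auto
    also have "(w - z) * cnj (w - z) = of_real ((norm (w - z))\<^sup>2)"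
      by (simp only: complex_norm_square[symmetric] of_real_power)
    also have "f w * c / of_real ((norm (w - z))\<^sup>2) = of_real (Poisson_kernel r t z) * f w"
      unfolding Poisson_kernel_def w_def[symmetric] c_def by simp
    finally show ?thesis by (simp add: w_def)
  qed
  with * show ?thesis by simp
qed

text \<open>
  As the real part of a holomorphic function of \<open>z\<close>, the kernel has the mean value property along \<open>\<phi>\<close>.
\<close>

lemma Poisson_kernel_mean_value:
  assumes \<phi>: "\<phi> holomorphic_on cball 0 \<rho>" and "\<phi> ` cball 0 \<rho> \<subseteq> ball 0 r" and "0 < \<rho>"
  shows "integral {0..2 * pi} (\<lambda>s. Poisson_kernel r t (\<phi> (of_real \<rho> * cis s)))
           = 2 * pi * Poisson_kernel r t (\<phi> 0)"
proof -
  define w where "w = of_real r * cis t"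
  have small: "norm (\<phi> u) < r" if "u \<in> cball 0 \<rho>" for u using assms(2) that by (auto dest: subsetD[OF _ imageI])
  define g where "g = (\<lambda>u. (w + \<phi> u) / (w - \<phi> u))"
  have "g holomorphic_on cball 0 \<rho>" unfolding g_def
    using circle_point_neq[OF small] by (intro holomorphic_intros \<phi>) (auto simp: w_def)
  from has_integral_Re[OF Cauchy_formula_circle[OF this, of 0]] \<open>0 < \<rho>\<close>
  have "((\<lambda>s. Re (g (of_real \<rho> * cis s))) has_integral 2 * pi * Re (g 0)) {0..2 * pi}"
    by simp
  moreover have "Re (g u) = Poisson_kernel r t (\<phi> u)" if "u \<in> cball 0 \<rho>" for u
    unfolding g_def w_def using Poisson_kernel_eq_Re[OF small[OF that]] by simp
  ultimately show ?thesis using \<open>0 < \<rho>\<close>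
    by (simp add: norm_mult integral_unique)
qed

lemma continuous_on_circle_powr:
  assumes "f holomorphic_on unit_disc" "continuous_on A u" "\<And>x. x \<in> A \<Longrightarrow> norm (u x) < 1" "0 < p"
  shows "continuous_on A (\<lambda>x. norm (f (u x)) powr p)"
proof -
  have "continuous_on A (\<lambda>x. f (u x))"
    by (rule continuous_on_compose2[OF holomorphic_on_imp_continuous_on[OF assms(1)] assms(2)]) (use assms(3) in auto)
  then show ?thesis using \<open>0 < p\<close> by (intro continuous_on_powr' continuous_intros) auto
qed

text \<open>
  Subharmonicity of \<open>\<bar>f\<bar>\<^sup>p\<close>. This is Jensen's inequality for the probability density given by the
  Poisson kernel: integrate the tangent of the power at \<open>\<bar>f z\<bar>\<close>.
\<close>

lemma norm_powr_le_Poisson_integral: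
  assumes "1 < p" and f: "f holomorphic_on unit_disc" and r: "r < 1" and z: "norm z < r"
  shows "2 * pi * norm (f z) powr p
           \<le> integral {0..2 * pi} (\<lambda>t. Poisson_kernel r t z * norm (f (of_real r * cis t)) powr p)"
proof -
  have "0 < r" using z norm_ge_zero order_le_less_trans by blast
  define y where "y = norm (f z)"
  define K where "K = (\<lambda>t. Poisson_kernel r t z)"
  define x where "x = (\<lambda>t. norm (f (of_real r * cis t)))"
  have K0: "0 \<le> K t" for t using Poisson_kernel_nonneg[OF z] by (simp add: K_def)
  have contK: "continuous_on {0..2*pi} K" unfolding K_def
    by (intro continuous_on_Poisson_kernel continuous_intros z)
  have contf: "continuous_on {0..2*pi} (\<lambda>t. f (of_real r * cis t))"
    by (rule continuous_on_compose2[OF holomorphic_on_imp_continuous_on[OF f]])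
       (use r \<open>0 < r\<close> in \<open>auto intro!: continuous_intros simp: norm_mult\<close>)
  then have contx: "continuous_on {0..2*pi} x" unfolding x_def by (intro continuous_intros)
  have contxp: "continuous_on {0..2*pi} (\<lambda>t. x t powr p)" unfolding x_def
    using \<open>0 < r\<close> r \<open>1 < p\<close> by (intro continuous_on_circle_powr f continuous_intros) (auto simp: norm_mult)
  have holr: "f holomorphic_on cball 0 r" using f r by (rule_tac holomorphic_on_subset) auto
  have total: "(K has_integral 2 * pi) {0..2*pi}"
    using has_integral_Re[OF Poisson_formula[of "\<lambda>_. 1", OF _ z]] by (simp add: K_def)
  have mean: "2 * pi * y \<le> integral {0..2*pi} (\<lambda>t. K t * x t)"
  proof -
    have "norm (integral {0..2*pi} (\<lambda>t. of_real (K t) * f (of_real r * cis t))) \<le> integral {0..2*pi} (\<lambda>t. K t * x t)"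
      using K0 contK contx contf
      by (intro integral_norm_bound_integral integrable_continuous_interval continuous_intros)
         (auto simp: norm_mult x_def)
    then show ?thesis
      using integral_unique[OF Poisson_formula[OF holr z]] by (simp add: K_def norm_mult y_def)
  qed
  show ?thesis
  proof (cases "y = 0")
    case True
    then show ?thesis
      using K0 contK contxp unfolding y_def K_def x_def
      by (auto intro!: integral_nonneg integrable_continuous_interval continuous_intros)
  next
    case False
    then have "0 < y" by (simp add: y_def)
    define c where "c = p * y powr (p - 1)"
    have "0 \<le> c" using \<open>1 < p\<close> by (simp add: c_def)
    have "2 * pi * y powr p \<le> 2 * pi * y powr p + c * (integral {0..2*pi} (\<lambda>t. K t * x t) - 2 * pi * y)"
      using mean \<open>0 \<le> c\<close> by auto
    also have "\<dots> = (y powr p - c * y) * integral {0..2*pi} K + c * integral {0..2*pi} (\<lambda>t. K t * x t)"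
      using integral_unique[OF total] by (simp add: algebra_simps)
    also have "\<dots> = integral {0..2*pi} (\<lambda>t. (y powr p - c * y) * K t + c * (K t * x t))"
      using contK contx
      by (subst integral_add) (auto intro!: integrable_continuous_interval continuous_intros)
    also have "\<dots> \<le> integral {0..2*pi} (\<lambda>t. K t * x t powr p)"
    proof (rule integral_le)
      fix t
      have "y powr p + c * (x t - y) \<le> x t powr p"
        unfolding c_def using \<open>1 < p\<close> \<open>0 < y\<close> by (intro powr_above_tangent) (auto simp: x_def)
      from mult_left_mono[OF this K0[of t]]
      show "(y powr p - c * y) * K t + c * (K t * x t) \<le> K t * x t powr p"
        by (simp add: algebra_simps)
    qed (use contK contx contxp in \<open>auto intro!: integrable_continuous_interval continuous_intros\<close>)
    finally show ?thesis by (simp add: K_def x_def y_def)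
  qed
qed

section \<open>Means over circles and Littlewood's subordination principle\<close>

text \<open>
  Littlewood's subordination principle on a pair of circles. The Poisson integral of \<open>\<bar>f\<bar>\<^sup>p\<close> over the
  outer circle dominates \<open>\<bar>f \<circ> \<phi>\<bar>\<^sup>p\<close>, and its mean over the inner circle is its value at \<open>\<phi> 0\<close> by
  Fubini and the mean value property of the kernel.
\<close>

lemma hardy_mean_compose_le:
  assumes "1 < p" and f: "f holomorphic_on unit_disc" and \<phi>: "\<phi> holomorphic_on unit_disc"
    and "0 < \<rho>" "\<rho> < 1" "r < 1" and sub: "\<phi> ` cball 0 \<rho> \<subseteq> ball 0 r"
  shows "hardy_mean p (\<lambda>z. f (\<phi> z)) \<rho> \<le> (r + norm (\<phi> 0)) / (r - norm (\<phi> 0)) * hardy_mean p f r"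
proof -
  define u where "u = (\<lambda>s. \<phi> (of_real \<rho> * cis s))"
  define F where "F = (\<lambda>t. norm (f (of_real r * cis t)) powr p)"
  define K where "K = (\<lambda>s t. Poisson_kernel r t (u s))"
  have "norm (\<phi> 0) < r" using subsetD[OF sub imageI[of 0]] \<open>0 < \<rho>\<close> by auto
  then have "0 < r" using norm_ge_zero order_le_less_trans by blast
  have ur: "norm (u s) < r" for s
    using sub \<open>0 < \<rho>\<close> unfolding u_def by (auto dest!: subsetD[OF _ imageI] simp: norm_mult)
  have contu: "continuous_on A u" for A unfolding u_def
    by (rule continuous_on_compose2[OF holomorphic_on_imp_continuous_on[OF \<phi>]])
       (use \<open>0 < \<rho>\<close> \<open>\<rho> < 1\<close> in \<open>auto intro!: continuous_intros simp: norm_mult\<close>)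
  have contF: "continuous_on A F" for A unfolding F_def
    using \<open>0 < r\<close> \<open>r < 1\<close> \<open>1 < p\<close> by (intro continuous_on_circle_powr f continuous_intros) (auto simp: norm_mult)
  have contfu: "continuous_on A (\<lambda>s. norm (f (u s)) powr p)" for A
    using \<open>r < 1\<close> \<open>1 < p\<close> less_trans[OF ur] by (intro continuous_on_circle_powr f contu) auto
  have "continuous_on A (\<lambda>x. K (fst x) (snd x) * F (snd x))" for A unfolding K_def
    by (intro continuous_intros continuous_on_Poisson_kernel ur
        continuous_on_compose2[OF contF[of UNIV]] continuous_on_compose2[OF contu[of UNIV]]) auto
  then have contKF: "continuous_on A (\<lambda>(s, t). K s t * F t)" for A by (simp add: case_prod_unfold)
  have "2 * pi * hardy_mean p (\<lambda>z. f (\<phi> z)) \<rho> = integral {0..2*pi} (\<lambda>s. 2 * pi * norm (f (u s)) powr p)"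
    by (simp add: hardy_mean_def u_def)
  also have "\<dots> \<le> integral {0..2*pi} (\<lambda>s. integral {0..2*pi} (\<lambda>t. K s t * F t))"
  proof (rule integral_le)
    show "2 * pi * norm (f (u s)) powr p \<le> integral {0..2*pi} (\<lambda>t. K s t * F t)" for s
      unfolding K_def F_def by (rule norm_powr_le_Poisson_integral[OF \<open>1 < p\<close> f \<open>r < 1\<close> ur])
    show "(\<lambda>s. integral {0..2*pi} (\<lambda>t. K s t * F t)) integrable_on {0..2*pi}"
      using integral_continuous_on_param[OF contKF, of "{0..2*pi}" 0 "2*pi"]
      by (auto intro!: integrable_continuous_interval)
  qed (auto intro!: integrable_continuous_interval continuous_intros contfu)
  also have "\<dots> = integral {0..2*pi} (\<lambda>t. integral {0..2*pi} (\<lambda>s. K s t * F t))"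
    using integral_swap_continuous[OF contKF, of 0 "2*pi" 0 "2*pi"] by simp
  also have "\<dots> = integral {0..2*pi} (\<lambda>t. 2 * pi * Poisson_kernel r t (\<phi> 0) * F t)"
    unfolding K_def u_def
    using Poisson_kernel_mean_value[OF holomorphic_on_subset[OF \<phi>] sub \<open>0 < \<rho>\<close>] \<open>\<rho> < 1\<close>
    by (simp add: cball_subset_ball_iff)
  also have "\<dots> \<le> integral {0..2*pi} (\<lambda>t. 2 * pi * ((r + norm (\<phi> 0)) / (r - norm (\<phi> 0)) * F t))"
    using Poisson_kernel_le[OF \<open>norm (\<phi> 0) < r\<close>]
    by (intro integral_le integrable_continuous_interval continuous_intros contF
         continuous_on_Poisson_kernel \<open>norm (\<phi> 0) < r\<close>)
       (auto simp: F_def mult.assoc intro!: mult_right_mono simp del: times_divide_eq_left)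
  also have "\<dots> = 2 * pi * ((r + norm (\<phi> 0)) / (r - norm (\<phi> 0)) * hardy_mean p f r)"
    by (simp add: hardy_mean_def F_def del: times_divide_eq_left)
  finally show ?thesis by (subst (asm) mult_le_cancel_left_pos) auto
qed

text \<open>
  Subordination for the identity map.
\<close>

lemma hardy_mean_mono:
  assumes "1 < p" "f holomorphic_on unit_disc" "0 < \<rho>" "\<rho> \<le> r" "r < 1"
  shows "hardy_mean p f \<rho> \<le> hardy_mean p f r"
proof (cases "\<rho> = r")
  case False
  then have "hardy_mean p (\<lambda>z. f z) \<rho> \<le> (r + norm (0::complex)) / (r - norm (0::complex)) * hardy_mean p f r"
    using assms by (intro hardy_mean_compose_le[of p f "\<lambda>z. z"]) auto
  with assms show ?thesis by auto
qed auto

text \<open>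
  The Hardy space without the convention that functions vanish outside the disc; this allows terms
  like \<open>\<lambda>z. f (g z)\<close>.
\<close>

definition hardy_class :: "real \<Rightarrow> (complex \<Rightarrow> complex) set" where
  "hardy_class p = {f. f holomorphic_on unit_disc \<and> bdd_above (hardy_mean p f ` {0<..<1})}"

text \<open>
  The \<open>p\<close>-th power of the Hardy norm.
\<close>

definition hardy_sup :: "real \<Rightarrow> (complex \<Rightarrow> complex) \<Rightarrow> real" where
  "hardy_sup p f = (SUP r\<in>{0<..<1}. hardy_mean p f r)"

lemma hardy_class_holomorphic: "f \<in> hardy_class p \<Longrightarrow> f holomorphic_on unit_disc"
  by (simp add: hardy_class_def)

lemma hardy_mean_le_sup:
  "f \<in> hardy_class p \<Longrightarrow> 0 < r \<Longrightarrow> r < 1 \<Longrightarrow> hardy_mean p f r \<le> hardy_sup p f"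
  unfolding hardy_sup_def hardy_class_def by (intro cSUP_upper) auto

lemma hardy_sup_least:
  "(\<And>r. 0 < r \<Longrightarrow> r < 1 \<Longrightarrow> hardy_mean p f r \<le> M) \<Longrightarrow> hardy_sup p f \<le> M"
  unfolding hardy_sup_def by (rule cSUP_least) auto

lemma hardy_classI:
  assumes "f holomorphic_on unit_disc" "\<And>r. 0 < r \<Longrightarrow> r < 1 \<Longrightarrow> hardy_mean p f r \<le> M"
  shows "f \<in> hardy_class p"
  unfolding hardy_class_def using assms by (auto intro!: bdd_aboveI2[of _ _ M])

lemma continuous_on_hardy_integrand:
  assumes "1 < p" "f holomorphic_on unit_disc" "0 < r" "r < 1"
  shows "continuous_on A (\<lambda>t. norm (f (of_real r * cis t)) powr p)"
  using assms by (intro continuous_on_circle_powr continuous_intros) (auto simp: norm_mult)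

lemma hardy_integrand_integrable:
  assumes "1 < p" "f holomorphic_on unit_disc" "0 < r" "r < 1"
  shows "(\<lambda>t. norm (f (of_real r * cis t)) powr p) integrable_on {0..2*pi}"
  by (intro integrable_continuous_interval continuous_on_hardy_integrand assms)

lemma hardy_mean_has_integral:
  assumes "1 < p" "0 < r" "r < 1" "f holomorphic_on unit_disc"
  shows "((\<lambda>t. norm (f (of_real r * cis t)) powr p) has_integral hardy_mean p f r) {0..2*pi}"
  unfolding hardy_mean_def by (intro integrable_integral hardy_integrand_integrable assms)

lemma hardy_mean_nonneg:
  assumes "1 < p" "f holomorphic_on unit_disc" "0 < r" "r < 1"
  shows "0 \<le> hardy_mean p f r"
  unfolding hardy_mean_def by (intro integral_nonneg hardy_integrand_integrable assms) auto

lemma hardy_sup_nonneg: "1 < p \<Longrightarrow> f \<in> hardy_class p \<Longrightarrow> 0 \<le> hardy_sup p f"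
  using hardy_mean_le_sup[of f p "1/2"] hardy_mean_nonneg[of p f "1/2"] hardy_class_holomorphic by force

text \<open>
  The supremum in the norm is a limit, so that inequalities between circle means which involve
  differences pass to \<open>hardy_sup\<close>.
\<close>

lemma hardy_mean_tendsto_sup:
  assumes "1 < p" "f \<in> hardy_class p"
  shows "(hardy_mean p f \<longlongrightarrow> hardy_sup p f) (at_left 1)"
proof (rule order_tendstoI)
  fix a assume "a < hardy_sup p f"
  then obtain \<rho> where \<rho>: "0 < \<rho>" "\<rho> < 1" "a < hardy_mean p f \<rho>"
    unfolding hardy_sup_def using assms(2) by (subst (asm) less_cSUP_iff) (auto simp: hardy_class_def)
  have "\<forall>\<^sub>F r in at_left 1. \<rho> < r \<and> r < 1"
    using \<rho> by (auto simp: eventually_at_left_field intro!: exI[of _ \<rho>])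
  then show "\<forall>\<^sub>F r in at_left 1. a < hardy_mean p f r"
    using \<rho> hardy_mean_mono[OF assms(1) hardy_class_holomorphic[OF assms(2)] \<rho>(1)]
    by (auto elim!: eventually_mono intro: less_le_trans)
next
  fix a assume "hardy_sup p f < a"
  moreover have "\<forall>\<^sub>F r in at_left 1. 0 < r \<and> r < (1::real)"
    by (auto simp: eventually_at_left_field intro!: exI[of _ 0])
  ultimately show "\<forall>\<^sub>F r in at_left 1. hardy_mean p f r < a"
    using hardy_mean_le_sup[OF assms(2)] by (force elim!: eventually_mono)
qed

text \<open>
  The principle for circles, as the outer radius tends to 1. For \<open>\<phi> 0 = 0\<close> the constant is 1.
\<close>

theorem hardy_sup_compose:
  assumes "1 < p" and f: "f \<in> hardy_class p" and \<phi>: "\<phi> holomorphic_on unit_disc"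
    and sub: "\<phi> ` unit_disc \<subseteq> unit_disc"
  shows hardy_class_compose: "(\<lambda>z. f (\<phi> z)) \<in> hardy_class p"
    and hardy_sup_compose_le:
      "hardy_sup p (\<lambda>z. f (\<phi> z)) \<le> (1 + norm (\<phi> 0)) / (1 - norm (\<phi> 0)) * hardy_sup p f"
proof -
  define b where "b = norm (\<phi> 0)"
  have "0 \<le> b" "b < 1" using subsetD[OF sub imageI[of 0]] by (auto simp: b_def)
  have le: "hardy_mean p (\<lambda>z. f (\<phi> z)) \<rho> \<le> (1 + b) / (1 - b) * hardy_sup p f"
    if \<rho>: "0 < \<rho>" "\<rho> < 1" for \<rho>
  proof -
    have "compact (\<phi> ` cball 0 \<rho>)"
      using \<rho> holomorphic_on_imp_continuous_on[OF \<phi>]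
      by (intro compact_continuous_image) (auto intro: continuous_on_subset)
    then have "\<exists>x\<in>\<phi> ` cball 0 \<rho>. \<forall>y\<in>\<phi> ` cball 0 \<rho>. norm y \<le> norm x"
      using \<rho> by (intro continuous_attains_sup[of "\<phi> ` cball 0 \<rho>" norm]) (auto intro!: continuous_intros)
    \<comment> \<open>The image of a closed disc stays at a positive distance from the unit circle.\<close>
    then obtain x where x: "x \<in> \<phi> ` cball 0 \<rho>" "\<And>y. y \<in> \<phi> ` cball 0 \<rho> \<Longrightarrow> norm y \<le> norm x" by blast
    have "norm x < 1" using x(1) sub \<rho> by (auto dest!: subsetD[OF _ imageI])
    have "b \<le> norm x" unfolding b_def using x(2) \<rho> by auto
    show ?thesis
    proof (rule tendsto_lowerbound)
      show "((\<lambda>r. (r + b) / (r - b) * hardy_sup p f) \<longlongrightarrow> (1 + b) / (1 - b) * hardy_sup p f) (at_left 1)"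
        using \<open>b < 1\<close> by (intro tendsto_intros) auto
      have "\<forall>\<^sub>F r in at_left 1. norm x < r \<and> r < 1"
        using \<open>norm x < 1\<close> by (auto simp: eventually_at_left_field)
      then show "\<forall>\<^sub>F r in at_left 1. hardy_mean p (\<lambda>z. f (\<phi> z)) \<rho> \<le> (r + b) / (r - b) * hardy_sup p f"
      proof eventually_elim
        case (elim r)
        then have "0 < r" using \<open>0 \<le> b\<close> \<open>b \<le> norm x\<close> by linarith
        have "\<phi> ` cball 0 \<rho> \<subseteq> ball 0 r" using x(2) elim by fastforce
        then have "hardy_mean p (\<lambda>z. f (\<phi> z)) \<rho> \<le> (r + b) / (r - b) * hardy_mean p f r"
          unfolding b_def using elim \<rho>
          by (intro hardy_mean_compose_le assms hardy_class_holomorphic[OF f]) auto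
        also have "\<dots> \<le> (r + b) / (r - b) * hardy_sup p f"
          using \<open>0 < r\<close> elim \<open>b \<le> norm x\<close> \<open>0 \<le> b\<close> hardy_mean_le_sup[OF f]
          by (intro mult_left_mono) auto
        finally show ?case .
      qed
    qed auto
  qed
  have "(\<lambda>z. f (\<phi> z)) holomorphic_on unit_disc"
    using holomorphic_on_compose_gen[OF \<phi> hardy_class_holomorphic[OF f] sub] by (simp add: o_def)
  then show "(\<lambda>z. f (\<phi> z)) \<in> hardy_class p" using le by (rule hardy_classI)
  show "hardy_sup p (\<lambda>z. f (\<phi> z)) \<le> (1 + norm (\<phi> 0)) / (1 - norm (\<phi> 0)) * hardy_sup p f"
    using le by (intro hardy_sup_least) (auto simp: b_def)
qed

lemma hardy_mean_const: "hardy_mean p (\<lambda>z. c) r = 2 * pi * norm c powr p"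
  by (simp add: hardy_mean_def)

text \<open>
  Subordination for the constant map with value \<open>z\<close>.
\<close>

lemma hardy_point_evaluation_bound:
  assumes "1 < p" "f \<in> hardy_class p" "norm z < 1"
  shows "2 * pi * norm (f z) powr p \<le> (1 + norm z) / (1 - norm z) * hardy_sup p f"
proof -
  have c: "(\<lambda>_. z) holomorphic_on unit_disc" "(\<lambda>_. z) ` unit_disc \<subseteq> unit_disc" using assms by auto
  have "hardy_mean p (\<lambda>_. f z) (1/2) \<le> hardy_sup p (\<lambda>_. f z)"
    using hardy_class_compose[OF assms(1,2) c] by (intro hardy_mean_le_sup) auto
  with hardy_sup_compose_le[OF assms(1,2) c] show ?thesis by (simp add: hardy_mean_const)
qed

lemma hardy_point_evaluation_tendsto:
  assumes "1 < p" "\<And>n. F n \<in> hardy_class p" "(\<lambda>n. hardy_sup p (F n)) \<longlonglongrightarrow> 0" "z \<in> unit_disc"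
  shows "(\<lambda>n. F n z) \<longlonglongrightarrow> 0"
proof -
  define c where "c = (1 + norm z) / (1 - norm z) / (2 * pi)"
  have le: "norm (F n z) powr p \<le> c * hardy_sup p (F n)" for n
    using hardy_point_evaluation_bound[OF assms(1,2), of z n] assms(4) by (simp add: c_def field_simps)
  have lim: "(\<lambda>n. (c * hardy_sup p (F n)) powr (1 / p)) \<longlonglongrightarrow> 0"
  proof (rule tendsto_zero_powrI[where b = "1 / p"])
    show "(\<lambda>n. c * hardy_sup p (F n)) \<longlonglongrightarrow> 0"
      using tendsto_mult[OF tendsto_const assms(3), of c] by simp
    show "\<forall>\<^sub>F n in sequentially. 0 \<le> c * hardy_sup p (F n)"
      using order_trans[OF _ le] by (intro always_eventually) auto
  qed (use \<open>1 < p\<close> in auto)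
  have "norm (F n z) \<le> (c * hardy_sup p (F n)) powr (1 / p)" for n
    using powr_mono2[OF _ _ le[of n], of "1 / p"] \<open>1 < p\<close> by (simp add: powr_powr)
  then show ?thesis
    by (intro Lim_null_comparison[OF _ lim]) auto
qed

section \<open>Convexity and completeness of the Hardy space\<close>

lemma hardy_mean_scale: "hardy_mean p (\<lambda>z. c * f z) r = norm c powr p * hardy_mean p f r"
  by (simp add: hardy_mean_def norm_mult powr_mult)

lemma
  assumes "1 < p" "f \<in> hardy_class p"
  shows hardy_class_scale: "(\<lambda>z. c * f z) \<in> hardy_class p"
    and hardy_sup_scale: "hardy_sup p (\<lambda>z. c * f z) = norm c powr p * hardy_sup p f"
proof -
  show *: "(\<lambda>z. c * f z) \<in> hardy_class p"
    using assms hardy_mean_le_sup[of f p] unfolding hardy_mean_scale[symmetric]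
    by (intro hardy_classI[of _ p "norm c powr p * hardy_sup p f"] holomorphic_intros hardy_class_holomorphic)
       (auto simp: hardy_mean_scale intro!: mult_left_mono)
  have "((\<lambda>r. norm c powr p * hardy_mean p f r) \<longlongrightarrow> norm c powr p * hardy_sup p f) (at_left 1)"
    by (intro tendsto_intros hardy_mean_tendsto_sup assms)
  with hardy_mean_tendsto_sup[OF assms(1) *]
  show "hardy_sup p (\<lambda>z. c * f z) = norm c powr p * hardy_sup p f"
    unfolding hardy_mean_scale by (intro tendsto_unique[rotated]) auto
qed

lemma
  assumes "1 < p" "f \<in> hardy_class p" "g \<in> hardy_class p" "0 \<le> t" "t \<le> 1"
  shows hardy_class_convex_combination: "(\<lambda>z. of_real (1 - t) * f z + of_real t * g z) \<in> hardy_class p"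
    and hardy_sup_convex_combination:
      "hardy_sup p (\<lambda>z. of_real (1 - t) * f z + of_real t * g z) \<le> (1 - t) * hardy_sup p f + t * hardy_sup p g"
proof -
  have f: "f holomorphic_on unit_disc" and g: "g holomorphic_on unit_disc"
    using assms hardy_class_holomorphic by auto
  have h: "(\<lambda>z. of_real (1 - t) * f z + of_real t * g z) holomorphic_on unit_disc"
    by (intro holomorphic_intros f g)
  have le: "hardy_mean p (\<lambda>z. of_real (1 - t) * f z + of_real t * g z) r \<le> (1 - t) * hardy_sup p f + t * hardy_sup p g"
    if r: "0 < r" "r < 1" for r
  proof -
    note I = hardy_mean_has_integral[OF \<open>1 < p\<close> r]
    have "((\<lambda>\<theta>. (1 - t) * norm (f (of_real r * cis \<theta>)) powr p + t * norm (g (of_real r * cis \<theta>)) powr p)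
        has_integral (1 - t) * hardy_mean p f r + t * hardy_mean p g r) {0..2*pi}"
      by (intro has_integral_add has_integral_mult_right I f g)
    from has_integral_le[OF I[OF h] this norm_powr_convex_combination[OF assms(1,4,5)]]
    have "hardy_mean p (\<lambda>z. of_real (1 - t) * f z + of_real t * g z) r
        \<le> (1 - t) * hardy_mean p f r + t * hardy_mean p g r" .
    also have "\<dots> \<le> (1 - t) * hardy_sup p f + t * hardy_sup p g"
      using assms r by (intro add_mono mult_left_mono hardy_mean_le_sup) auto
    finally show ?thesis .
  qed
  show "(\<lambda>z. of_real (1 - t) * f z + of_real t * g z) \<in> hardy_class p" using h le by (rule hardy_classI)
  show "hardy_sup p (\<lambda>z. of_real (1 - t) * f z + of_real t * g z) \<le> (1 - t) * hardy_sup p f + t * hardy_sup p g"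
    using le by (rule hardy_sup_least)
qed

lemma hardy_class_lincomb:
  assumes "1 < p" "f \<in> hardy_class p" "g \<in> hardy_class p"
  shows "(\<lambda>z. c * f z + d * g z) \<in> hardy_class p"
  using hardy_class_convex_combination[OF assms(1) hardy_class_scale[OF assms(1,2), of "2 * c"]
      hardy_class_scale[OF assms(1,3), of "2 * d"], of "1/2"]
  by simp

text \<open>
  The pointwise inequality is integrated over the circle of radius \<open>r\<close>. On the right the mean of the
  midpoint occurs with a negative sign, so the supremum has to be approached as a limit \<open>r \<rightarrow> 1\<close>.
\<close>

lemma hardy_sup_uniformly_convex:
  assumes "1 < p" "0 < \<epsilon>"
  obtains C where "0 \<le> C"
    "\<And>f g. f \<in> hardy_class p \<Longrightarrow> g \<in> hardy_class p \<Longrightarrow>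
       hardy_sup p (\<lambda>z. f z - g z) \<le> \<epsilon> * (hardy_sup p f + hardy_sup p g)
         + C * ((hardy_sup p f + hardy_sup p g) / 2 - hardy_sup p (\<lambda>z. (f z + g z) / 2))"
proof -
  obtain C where C: "0 \<le> C"
    "\<And>a b :: complex. norm (a - b) powr p
        \<le> \<epsilon> * (norm a powr p + norm b powr p)
          + C * ((norm a powr p + norm b powr p) / 2 - norm ((a + b) / 2) powr p)"
    using norm_powr_uniformly_convex[OF assms] by blast
  show thesis
  proof (rule that[OF C(1)])
    fix f g assume fg: "f \<in> hardy_class p" "g \<in> hardy_class p"
    have d: "(\<lambda>z. f z - g z) \<in> hardy_class p" and m: "(\<lambda>z. (f z + g z) / 2) \<in> hardy_class p"
      using hardy_class_lincomb[OF \<open>1 < p\<close> fg, of 1 "-1"] hardy_class_lincomb[OF \<open>1 < p\<close> fg, of "1/2" "1/2"]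
      by (simp_all add: add_divide_distrib)
    note hol = fg[THEN hardy_class_holomorphic] d[THEN hardy_class_holomorphic] m[THEN hardy_class_holomorphic]
    have "hardy_mean p (\<lambda>z. f z - g z) r \<le> \<epsilon> * (hardy_mean p f r + hardy_mean p g r)
         + C * ((hardy_mean p f r + hardy_mean p g r) / 2 - hardy_mean p (\<lambda>z. (f z + g z) / 2) r)"
      if r: "0 < r" "r < 1" for r
    proof -
      note I = hardy_mean_has_integral[OF \<open>1 < p\<close> r]
      have split: "(\<epsilon> + C / 2) * A + (\<epsilon> + C / 2) * B - C * M = \<epsilon> * (A + B) + C * ((A + B) / 2 - M)"
        for A B M :: real by (simp add: field_simps)
      have "hardy_mean p (\<lambda>z. f z - g z) r \<le> (\<epsilon> + C / 2) * hardy_mean p f r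
          + (\<epsilon> + C / 2) * hardy_mean p g r - C * hardy_mean p (\<lambda>z. (f z + g z) / 2) r"
      proof (rule has_integral_le[OF I[OF hol(3)]])
        show "((\<lambda>\<theta>. (\<epsilon> + C / 2) * norm (f (of_real r * cis \<theta>)) powr p
              + (\<epsilon> + C / 2) * norm (g (of_real r * cis \<theta>)) powr p
              - C * norm ((f (of_real r * cis \<theta>) + g (of_real r * cis \<theta>)) / 2) powr p) has_integral
            (\<epsilon> + C / 2) * hardy_mean p f r + (\<epsilon> + C / 2) * hardy_mean p g r
              - C * hardy_mean p (\<lambda>z. (f z + g z) / 2) r) {0..2*pi}"
          by (intro has_integral_diff has_integral_add has_integral_mult_right I hol)
      qed (unfold split, rule C(2))
      then show ?thesis unfolding split .
    qed
    then have ev: "\<forall>\<^sub>F r in at_left 1. hardy_mean p (\<lambda>z. f z - g z) r \<le> \<epsilon> * (hardy_mean p f r + hardy_mean p g r)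
         + C * ((hardy_mean p f r + hardy_mean p g r) / 2 - hardy_mean p (\<lambda>z. (f z + g z) / 2) r)"
      by (auto simp: eventually_at_left_field intro!: exI[of _ 0])
    show "hardy_sup p (\<lambda>z. f z - g z) \<le> \<epsilon> * (hardy_sup p f + hardy_sup p g)
         + C * ((hardy_sup p f + hardy_sup p g) / 2 - hardy_sup p (\<lambda>z. (f z + g z) / 2))"
      by (rule tendsto_le[OF _ _ _ ev]) (auto intro!: tendsto_intros hardy_mean_tendsto_sup fg d m \<open>1 < p\<close>)
  qed
qed

lemma hardy_mean_cong:
  assumes "\<And>z. z \<in> unit_disc \<Longrightarrow> f z = g z" "0 < r" "r < 1"
  shows "hardy_mean p f r = hardy_mean p g r"
  unfolding hardy_mean_def using assms by (intro integral_cong) (simp add: norm_mult)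

lemma hardy_sup_cong:
  assumes "\<And>z. z \<in> unit_disc \<Longrightarrow> f z = g z"
  shows "hardy_sup p f = hardy_sup p g"
  unfolding hardy_sup_def using hardy_mean_cong[OF assms] by (intro SUP_cong) auto

lemma hardy_class_cong:
  assumes "\<And>z. z \<in> unit_disc \<Longrightarrow> f z = g z" "f \<in> hardy_class p"
  shows "g \<in> hardy_class p"
proof (rule hardy_classI)
  show "g holomorphic_on unit_disc"
    using assms hardy_class_holomorphic holomorphic_cong by blast
  show "hardy_mean p g r \<le> hardy_sup p f" if "0 < r" "r < 1" for r
    using hardy_mean_cong[OF assms(1) that] hardy_mean_le_sup[OF assms(2) that] by simp
qed

text \<open>
  Point evaluations are bounded uniformly on compact sets, so the sequence converges locally uniformly
  to a holomorphic function. On a fixed circle the limit may then be compared with a late member of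
  the sequence, as in Fatou's lemma.
\<close>

theorem hardy_class_complete:
  assumes p: "1 < p" and F: "\<And>n. F n \<in> hardy_class p"
    and Cauchy: "\<And>\<epsilon>. 0 < \<epsilon> \<Longrightarrow> \<exists>N. \<forall>m\<ge>N. \<forall>n\<ge>N. hardy_sup p (\<lambda>z. F m z - F n z) \<le> \<epsilon>"
  obtains L where "L \<in> hardy_class p" "\<And>z. z \<in> unit_disc \<Longrightarrow> (\<lambda>n. F n z) \<longlonglongrightarrow> L z"
    "(\<lambda>n. hardy_sup p (\<lambda>z. F n z - L z)) \<longlonglongrightarrow> 0"
proof -
  define L where "L = (\<lambda>z. lim (\<lambda>n. F n z))"
  have diff: "(\<lambda>z. F m z - F n z) \<in> hardy_class p" for m n
    using hardy_class_lincomb[OF p F F, of 1 m "-1" n] by simp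
  have unif: "uniform_limit (cball 0 \<rho>) F L sequentially" if \<rho>: "0 < \<rho>" "\<rho> < 1" for \<rho>
  proof -
    define A where "A = (1 + \<rho>) / (1 - \<rho>)"
    define c where "c = A / (2 * pi)"
    have "0 < c" using \<rho> by (simp add: c_def A_def)
    have "uniformly_Cauchy_on (cball 0 \<rho>) F"
    proof (rule uniformly_Cauchy_onI)
      fix e :: real assume "0 < e"
      define \<epsilon> where "\<epsilon> = (e / 2) powr p / c"
      have "0 < \<epsilon>" using \<open>0 < e\<close> \<open>0 < c\<close> by (simp add: \<epsilon>_def)
      from Cauchy[OF this] obtain N where N: "\<And>m n. m \<ge> N \<Longrightarrow> n \<ge> N \<Longrightarrow> hardy_sup p (\<lambda>z. F m z - F n z) \<le> \<epsilon>"
        by blast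
      have "dist (F m x) (F n x) < e" if "x \<in> cball 0 \<rho>" "N \<le> m" "N \<le> n" for x m n
      proof -
        have x: "norm x \<le> \<rho>" "norm x < 1" using that \<rho> by auto
        have "(1 + norm x) / (1 - norm x) \<le> A" unfolding A_def
          using x \<rho> by (intro frac_le) auto
        then have "2 * pi * norm (F m x - F n x) powr p \<le> A * \<epsilon>"
          using hardy_point_evaluation_bound[OF p diff x(2), of m n] N[OF that(2,3)] hardy_sup_nonneg[OF p diff, of m n]
            x \<rho> \<open>0 < c\<close> by (elim order_trans) (intro mult_mono, auto simp: c_def zero_less_divide_iff)
        then have "norm (F m x - F n x) powr p \<le> c * \<epsilon>"
          by (simp add: c_def field_simps)
        also have "\<dots> = (e / 2) powr p" using \<open>0 < c\<close> by (simp add: \<epsilon>_def)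
        finally have "norm (F m x - F n x) \<le> e / 2"
          using powr_less_mono2[of p "e / 2" "norm (F m x - F n x)"] \<open>0 < e\<close> p by fastforce
        then show ?thesis using \<open>0 < e\<close> by (simp add: dist_norm)
      qed
      then show "\<exists>M. \<forall>x\<in>cball 0 \<rho>. \<forall>m\<ge>M. \<forall>n\<ge>M. dist (F m x) (F n x) < e" by blast
    qed
    then show ?thesis unfolding L_def
      by (simp add: uniformly_convergent_uniform_limit_iff[symmetric] Cauchy_uniformly_convergent)
  qed
  have lim: "(\<lambda>n. F n z) \<longlonglongrightarrow> L z" if "z \<in> unit_disc" for z
  proof -
    have "norm z < 1" using that by simp
    then obtain \<rho> where "norm z < \<rho>" "\<rho> < 1" using dense by blast
    then show ?thesis
      using order_le_less_trans[OF norm_ge_zero] by (intro tendsto_uniform_limitI[OF unif[of \<rho>]]) auto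
  qed
  have L: "L holomorphic_on unit_disc"
  proof (rule holomorphic_uniform_sequence[OF open_ball])
    show "F n holomorphic_on unit_disc" for n using F by (rule hardy_class_holomorphic)
    fix x assume "x \<in> unit_disc"
    then have x: "norm x < 1" by simp
    define d where "d = (1 - norm x) / 2"
    have "0 < d" "norm x + d < 1" using x by (auto simp: d_def field_simps)
    then have sub: "cball x d \<subseteq> cball 0 (norm x + d)"
      by (simp add: cball_subset_cball_iff)
    show "\<exists>d>0. cball x d \<subseteq> unit_disc \<and> uniform_limit (cball x d) F L sequentially"
    proof (intro exI[of _ d] conjI)
      show "cball x d \<subseteq> unit_disc" using sub \<open>norm x + d < 1\<close> by fastforce
      show "uniform_limit (cball x d) F L sequentially"
        using \<open>0 < d\<close> \<open>norm x + d < 1\<close>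
        by (intro uniform_limit_on_subset[OF unif sub]) (auto intro: add_nonneg_pos)
    qed fact
  qed
  have bound: "\<exists>N. \<forall>n\<ge>N. \<forall>r. 0 < r \<longrightarrow> r < 1 \<longrightarrow> hardy_mean p (\<lambda>z. F n z - L z) r \<le> \<epsilon>" if "0 < \<epsilon>" for \<epsilon>
  proof -
    define \<eta> where "\<eta> = \<epsilon> / (2 powr p * (1 + 2 * pi))"
    have "0 < \<eta>" using \<open>0 < \<epsilon>\<close> by (simp add: \<eta>_def add_pos_pos)
    from Cauchy[OF this] obtain N where N: "\<And>m n. m \<ge> N \<Longrightarrow> n \<ge> N \<Longrightarrow> hardy_sup p (\<lambda>z. F m z - F n z) \<le> \<eta>"
      by blast
    have "hardy_mean p (\<lambda>z. F n z - L z) r \<le> \<epsilon>" if "N \<le> n" "0 < r" "r < 1" for n r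
    proof -
      have "\<forall>\<^sub>F m in sequentially. \<forall>x\<in>cball 0 r. dist (F m x) (L x) < \<eta> powr (1 / p)"
        using unif[OF that(2,3)] \<open>0 < \<eta>\<close> by (intro uniform_limitD) auto
      then obtain m where "N \<le> m" and m: "\<And>x. x \<in> cball 0 r \<Longrightarrow> dist (F m x) (L x) < \<eta> powr (1 / p)"
        unfolding eventually_sequentially by (meson nat_le_linear)
      note I = hardy_mean_has_integral[OF p that(2,3)]
      have hol: "(\<lambda>z. F n z - L z) holomorphic_on unit_disc" "(\<lambda>z. F n z - F m z) holomorphic_on unit_disc"
        by (intro holomorphic_intros L F[THEN hardy_class_holomorphic])+
      have "hardy_mean p (\<lambda>z. F n z - L z) r \<le> 2 powr p * (hardy_mean p (\<lambda>z. F n z - F m z) r + 2 * pi * \<eta>)"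
      proof (rule has_integral_le[OF I[OF hol(1)]])
        show "((\<lambda>t. 2 powr p * (norm (F n (of_real r * cis t) - F m (of_real r * cis t)) powr p + \<eta>)) has_integral
            2 powr p * (hardy_mean p (\<lambda>z. F n z - F m z) r + 2 * pi * \<eta>)) {0..2*pi}"
          using has_integral_const_real[of \<eta> 0 "2*pi"]
          by (intro has_integral_mult_right has_integral_add I[OF hol(2)]) auto
        fix t
        define w where "w = of_real r * cis t"
        have "norm (F m w - L w) powr p \<le> (\<eta> powr (1 / p)) powr p"
          using m[of w] that p by (intro powr_mono2) (auto simp: w_def norm_mult dist_norm)
        also have "\<dots> = \<eta>" using p \<open>0 < \<eta>\<close> by (simp add: powr_powr)
        finally have small: "norm (F m w - L w) powr p \<le> \<eta>" .
        have "norm (F n w - L w) powr p \<le> 2 powr p * (norm (F n w - F m w) powr p + norm (F m w - L w) powr p)"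
          using norm_powr_add_le[OF p, of "F n w - F m w" "F m w - L w"] by simp
        also have "\<dots> \<le> 2 powr p * (norm (F n w - F m w) powr p + \<eta>)"
          using small by (intro mult_left_mono) auto
        finally show "norm (F n w - L w) powr p \<le> 2 powr p * (norm (F n w - F m w) powr p + \<eta>)" .
      qed
      also have "\<dots> \<le> 2 powr p * (\<eta> + 2 * pi * \<eta>)"
        using hardy_mean_le_sup[OF diff that(2,3), of n m] N[OF that(1) \<open>N \<le> m\<close>]
        by (intro mult_left_mono add_right_mono) auto
      also have "\<dots> = 2 powr p * (1 + 2 * pi) * \<eta>" by (simp add: algebra_simps)
      also have "\<dots> = \<epsilon>"
        using pi_gt_zero by (simp add: \<eta>_def add_pos_pos order_less_imp_not_eq2)
      finally show ?thesis .
    qed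
    then show ?thesis by blast
  qed
  obtain N where N: "\<And>n r. N \<le> n \<Longrightarrow> 0 < r \<Longrightarrow> r < 1 \<Longrightarrow> hardy_mean p (\<lambda>z. F n z - L z) r \<le> 1"
    using bound[of 1] by auto
  have "(\<lambda>z. F N z - L z) \<in> hardy_class p"
    using N[of N] by (intro hardy_classI[of _ p 1] holomorphic_intros L F[THEN hardy_class_holomorphic]) auto
  from hardy_class_lincomb[OF p F this, of 1 N "-1"]
  have LH: "L \<in> hardy_class p" by simp
  have dL: "(\<lambda>z. F n z - L z) \<in> hardy_class p" for n
    using hardy_class_lincomb[OF p F LH, of 1 n "-1"] by simp
  have "(\<lambda>n. hardy_sup p (\<lambda>z. F n z - L z)) \<longlonglongrightarrow> 0"
  proof (rule LIMSEQ_I)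
    fix e :: real assume "0 < e"
    then obtain N where N: "\<And>n r. N \<le> n \<Longrightarrow> 0 < r \<Longrightarrow> r < 1 \<Longrightarrow> hardy_mean p (\<lambda>z. F n z - L z) r \<le> e / 2"
      using bound[of "e / 2"] by auto
    have "norm (hardy_sup p (\<lambda>z. F n z - L z) - 0) < e" if "N \<le> n" for n
    proof -
      have "hardy_sup p (\<lambda>z. F n z - L z) \<le> e / 2" using N[OF that] by (rule hardy_sup_least)
      then show ?thesis using hardy_sup_nonneg[OF p dL, of n] \<open>0 < e\<close> by simp
    qed
    then show "\<exists>no. \<forall>n\<ge>no. norm (hardy_sup p (\<lambda>z. F n z - L z) - 0) < e" by blast
  qed
  with LH lim show thesis by (rule that)
qed

section \<open>The mean ergodic theorem in uniformly convex spaces\<close>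

definition ergodic_mean ::
  "(('s \<Rightarrow> complex) \<Rightarrow> ('s \<Rightarrow> complex)) \<Rightarrow> nat \<Rightarrow> ('s \<Rightarrow> complex) \<Rightarrow> ('s \<Rightarrow> complex)" where
  "ergodic_mean T n f = (\<lambda>x. (\<Sum>k<n. (T ^^ k) f x) / of_nat n)"

lemma ergodic_mean_0: "ergodic_mean T 0 f = (\<lambda>x. 0)"
  by (simp add: ergodic_mean_def)

text \<open>
  The recursion by convex combinations, through which convexity arguments reach the ergodic means. It
  is correct also for \<open>n = 0\<close>, where the weight of the mean of no terms is 0.
\<close>

lemma ergodic_mean_Suc:
  "ergodic_mean T (Suc n) f =
     (\<lambda>x. of_real (1 - 1 / real (Suc n)) * ergodic_mean T n f x + of_real (1 / real (Suc n)) * (T ^^ n) f x)"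
proof (cases "n = 0")
  case True
  then show ?thesis by (simp add: ergodic_mean_def)
next
  case False
  have "1 - 1 / real (Suc n) = real n / real (Suc n)" by (simp add: field_simps)
  then show ?thesis using False by (auto simp: ergodic_mean_def add_divide_distrib simp del: of_nat_Suc)
qed

lemma ergodic_mean_shift:
  "ergodic_mean T n (T f) x - ergodic_mean T n f x = ((T ^^ n) f x - f x) / of_nat n"
proof -
  have "(\<Sum>k<n. (T ^^ k) (T f) x) - (\<Sum>k<n. (T ^^ k) f x) = (\<Sum>k<n. (T ^^ Suc k) f x - (T ^^ k) f x)"
    by (simp add: sum_subtractf funpow_swap1)
  also have "\<dots> = (T ^^ n) f x - f x"
    by (subst sum_lessThan_telescope) simp
  finally show ?thesis by (simp add: ergodic_mean_def flip: diff_divide_distrib)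
qed

text \<open>
  The functional \<open>S\<close> stands for the \<open>p\<close>-th power of a uniformly convex norm on \<open>X\<close>, and \<open>T\<close> for a
  linear contraction.
\<close>

locale uniformly_convex_contraction =
  fixes X :: "('s \<Rightarrow> complex) set" and S :: "('s \<Rightarrow> complex) \<Rightarrow> real" and p :: real
    and T :: "('s \<Rightarrow> complex) \<Rightarrow> ('s \<Rightarrow> complex)"
  assumes p: "1 < p"
    and lincomb: "f \<in> X \<Longrightarrow> g \<in> X \<Longrightarrow> (\<lambda>x. c * f x + d * g x) \<in> X"
    and nonneg: "f \<in> X \<Longrightarrow> 0 \<le> S f"
    and scale: "f \<in> X \<Longrightarrow> S (\<lambda>x. c * f x) = norm c powr p * S f"
    and convex: "f \<in> X \<Longrightarrow> g \<in> X \<Longrightarrow> 0 \<le> t \<Longrightarrow> t \<le> 1 \<Longrightarrow>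
        S (\<lambda>x. of_real (1 - t) * f x + of_real t * g x) \<le> (1 - t) * S f + t * S g"
    and uniform: "0 < \<epsilon> \<Longrightarrow> \<exists>C\<ge>0. \<forall>f\<in>X. \<forall>g\<in>X.
        S (\<lambda>x. f x - g x) \<le> \<epsilon> * (S f + S g) + C * ((S f + S g) / 2 - S (\<lambda>x. (f x + g x) / 2))"
    and T_in: "f \<in> X \<Longrightarrow> T f \<in> X"
    and T_lincomb: "f \<in> X \<Longrightarrow> g \<in> X \<Longrightarrow> T (\<lambda>x. c * f x + d * g x) = (\<lambda>x. c * T f x + d * T g x)"
    and T_contraction: "f \<in> X \<Longrightarrow> S (T f) \<le> S f"

context uniformly_convex_contraction
begin

lemma zero_in: "f \<in> X \<Longrightarrow> (\<lambda>x. 0) \<in> X"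
  using lincomb[of f f 0 0] by simp

lemma S_zero: "f \<in> X \<Longrightarrow> S (\<lambda>x. 0) = 0"
  using scale[of f 0] by simp

lemma diff_in: "f \<in> X \<Longrightarrow> g \<in> X \<Longrightarrow> (\<lambda>x. f x - g x) \<in> X"
  using lincomb[of f g 1 "-1"] by simp

lemma S_diff_commute: "f \<in> X \<Longrightarrow> g \<in> X \<Longrightarrow> S (\<lambda>x. f x - g x) = S (\<lambda>x. g x - f x)"
  using scale[OF diff_in, of g f "-1"] by simp

text \<open>
  The substitute for the triangle inequality.
\<close>

lemma S_add_le:
  assumes "f \<in> X" "g \<in> X"
  shows "S (\<lambda>x. f x + g x) \<le> 2 powr p * (S f + S g)"
proof -
  have m: "(\<lambda>x. of_real (1 - 1/2) * f x + of_real (1/2) * g x) \<in> X" using assms by (rule lincomb)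
  have "S (\<lambda>x. f x + g x) = S (\<lambda>x. 2 * (of_real (1 - 1/2) * f x + of_real (1/2) * g x))"
    by (simp add: algebra_simps)
  also have "\<dots> = 2 powr p * S (\<lambda>x. of_real (1 - 1/2) * f x + of_real (1/2) * g x)"
    by (subst scale[OF m]) simp
  also have "\<dots> \<le> 2 powr p * ((1 - 1/2) * S f + 1/2 * S g)"
    using assms by (intro mult_left_mono convex) auto
  also have "\<dots> \<le> 2 powr p * (S f + S g)"
    using nonneg[OF assms(1)] nonneg[OF assms(2)] by (intro mult_left_mono) auto
  finally show ?thesis .
qed

lemma S_diff_triangle:
  assumes "f \<in> X" "g \<in> X" "h \<in> X"
  shows "S (\<lambda>x. f x - h x) \<le> 2 powr p * (S (\<lambda>x. f x - g x) + S (\<lambda>x. g x - h x))"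
  using S_add_le[OF diff_in diff_in, of f g g h] assms by simp

lemma iterate_in: "f \<in> X \<Longrightarrow> (T ^^ k) f \<in> X"
  by (induction k) (auto intro: T_in)

lemma S_iterate_le: "f \<in> X \<Longrightarrow> S ((T ^^ k) f) \<le> S f"
  by (induction k) (auto intro: order_trans[OF T_contraction] iterate_in)

lemma iterate_lincomb:
  "f \<in> X \<Longrightarrow> g \<in> X \<Longrightarrow> (T ^^ k) (\<lambda>x. c * f x + d * g x) = (\<lambda>x. c * (T ^^ k) f x + d * (T ^^ k) g x)"
  by (induction k) (auto simp: T_lincomb iterate_in)

lemma mean_in: "f \<in> X \<Longrightarrow> ergodic_mean T n f \<in> X"
  by (induction n) (simp_all only: ergodic_mean_0 zero_in ergodic_mean_Suc lincomb iterate_in)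

lemma mean_lincomb:
  assumes "f \<in> X" "g \<in> X"
  shows "ergodic_mean T n (\<lambda>x. c * f x + d * g x) = (\<lambda>x. c * ergodic_mean T n f x + d * ergodic_mean T n g x)"
  by (simp add: ergodic_mean_def iterate_lincomb[OF assms] sum.distrib sum_distrib_left add_divide_distrib)

lemma S_mean_le:
  assumes "f \<in> X" shows "S (ergodic_mean T n f) \<le> S f"
proof (induction n)
  case 0
  then show ?case using assms by (simp add: ergodic_mean_0 S_zero nonneg)
next
  case (Suc n)
  define t where "t = 1 / real (Suc n)"
  have t: "0 \<le> t" "t \<le> 1" by (auto simp: t_def)
  have "S (ergodic_mean T (Suc n) f) \<le> (1 - t) * S (ergodic_mean T n f) + t * S ((T ^^ n) f)"
    unfolding ergodic_mean_Suc t_def[symmetric] using assms t by (intro convex mean_in iterate_in)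
  also have "\<dots> \<le> (1 - t) * S f + t * S f"
    using t Suc S_iterate_le[OF assms] by (intro add_mono mult_left_mono) auto
  finally show ?case by (simp add: algebra_simps)
qed

text \<open>
  The vectors whose ergodic means are asymptotic to those of \<open>f\<close>. This convex \<open>T\<close>-invariant set
  contains the convex hull of the orbit of \<open>f\<close>, and replaces it in the classical argument.
\<close>

definition equi_ergodic :: "('s \<Rightarrow> complex) \<Rightarrow> ('s \<Rightarrow> complex) set" where
  "equi_ergodic f = {h \<in> X. (\<lambda>n. S (\<lambda>x. ergodic_mean T n h x - ergodic_mean T n f x)) \<longlonglongrightarrow> 0}"

lemma equi_ergodic_in: "h \<in> equi_ergodic f \<Longrightarrow> h \<in> X"
  by (simp add: equi_ergodic_def)

lemma equi_ergodic_self: "f \<in> X \<Longrightarrow> f \<in> equi_ergodic f"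
  by (simp add: equi_ergodic_def S_zero)

text \<open>
  The sums for \<open>T h\<close> and \<open>h\<close> differ only in their first and last terms, which are bounded.
\<close>

lemma equi_ergodic_image:
  assumes f: "f \<in> X" and "h \<in> equi_ergodic f"
  shows "T h \<in> equi_ergodic f"
proof -
  have h: "h \<in> X" and lim: "(\<lambda>n. S (\<lambda>x. ergodic_mean T n h x - ergodic_mean T n f x)) \<longlonglongrightarrow> 0"
    using assms by (auto simp: equi_ergodic_def)
  have shift: "S (\<lambda>x. ergodic_mean T n (T h) x - ergodic_mean T n h x)
      \<le> (1 / real n) powr p * (2 powr p * (S h + S h))" for n
  proof -
    have d: "(\<lambda>x. (T ^^ n) h x - h x) \<in> X" by (intro diff_in iterate_in h)
    have "S (\<lambda>x. ergodic_mean T n (T h) x - ergodic_mean T n h x)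
        = S (\<lambda>x. of_real (1 / real n) * ((T ^^ n) h x - h x))"
      unfolding ergodic_mean_shift by simp
    also have "\<dots> = (1 / real n) powr p * S (\<lambda>x. (T ^^ n) h x - h x)"
      by (subst scale[OF d]) (simp add: norm_divide)
    also have "S (\<lambda>x. (T ^^ n) h x - h x) \<le> 2 powr p * (S ((T ^^ n) h) + S h)"
      using S_diff_triangle[OF iterate_in[OF h] zero_in[OF h] h, of n]
        scale[OF h, of "-1"] by simp
    also have "\<dots> \<le> 2 powr p * (S h + S h)"
      using S_iterate_le[OF h] by (intro mult_left_mono) auto
    finally show ?thesis by (simp add: mult_left_mono)
  qed
  have "(\<lambda>n. 2 powr p * ((1 / real n) powr p * (2 powr p * (S h + S h))
          + S (\<lambda>x. ergodic_mean T n h x - ergodic_mean T n f x))) \<longlonglongrightarrow> 2 powr p * (0 * (2 powr p * (S h + S h)) + 0)"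
    using p lim_1_over_n by (intro tendsto_intros lim tendsto_zero_powrI[where b = p]) auto
  then have lim': "(\<lambda>n. 2 powr p * ((1 / real n) powr p * (2 powr p * (S h + S h))
          + S (\<lambda>x. ergodic_mean T n h x - ergodic_mean T n f x))) \<longlonglongrightarrow> 0" by simp
  have "(\<lambda>n. S (\<lambda>x. ergodic_mean T n (T h) x - ergodic_mean T n f x)) \<longlonglongrightarrow> 0"
  proof (rule tendsto_sandwich[OF _ _ tendsto_const lim'])
    show "\<forall>\<^sub>F n in sequentially. 0 \<le> S (\<lambda>x. ergodic_mean T n (T h) x - ergodic_mean T n f x)"
      by (intro always_eventually allI nonneg diff_in mean_in T_in f h)
    show "\<forall>\<^sub>F n in sequentially. S (\<lambda>x. ergodic_mean T n (T h) x - ergodic_mean T n f x)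
      \<le> 2 powr p * ((1 / real n) powr p * (2 powr p * (S h + S h))
          + S (\<lambda>x. ergodic_mean T n h x - ergodic_mean T n f x))"
    proof (intro always_eventually allI)
      fix n
      have "S (\<lambda>x. ergodic_mean T n (T h) x - ergodic_mean T n f x) \<le> 2 powr p *
         (S (\<lambda>x. ergodic_mean T n (T h) x - ergodic_mean T n h x) + S (\<lambda>x. ergodic_mean T n h x - ergodic_mean T n f x))"
        by (intro S_diff_triangle mean_in T_in f h)
      also have "\<dots> \<le> 2 powr p * ((1 / real n) powr p * (2 powr p * (S h + S h))
          + S (\<lambda>x. ergodic_mean T n h x - ergodic_mean T n f x))"
        using shift by (intro mult_left_mono add_right_mono) auto
      finally show "S (\<lambda>x. ergodic_mean T n (T h) x - ergodic_mean T n f x) \<le> \<dots>" .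
    qed
  qed
  then show ?thesis using h by (simp add: equi_ergodic_def T_in)
qed

lemma equi_ergodic_convex:
  assumes f: "f \<in> X" and "g \<in> equi_ergodic f" "h \<in> equi_ergodic f" and t: "0 \<le> t" "t \<le> 1"
  shows "(\<lambda>x. of_real (1 - t) * g x + of_real t * h x) \<in> equi_ergodic f"
proof -
  have g: "g \<in> X" "(\<lambda>n. S (\<lambda>x. ergodic_mean T n g x - ergodic_mean T n f x)) \<longlonglongrightarrow> 0"
    and h: "h \<in> X" "(\<lambda>n. S (\<lambda>x. ergodic_mean T n h x - ergodic_mean T n f x)) \<longlonglongrightarrow> 0"
    using assms by (auto simp: equi_ergodic_def)
  define k where "k = (\<lambda>x. of_real (1 - t) * g x + of_real t * h x)"
  have k: "k \<in> X" unfolding k_def using g h by (intro lincomb)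
  have eq: "ergodic_mean T n k x - ergodic_mean T n f x
      = of_real (1 - t) * (ergodic_mean T n g x - ergodic_mean T n f x)
        + of_real t * (ergodic_mean T n h x - ergodic_mean T n f x)" for n x
    unfolding k_def mean_lincomb[OF g(1) h(1)] by (simp add: algebra_simps)
  have le: "S (\<lambda>x. ergodic_mean T n k x - ergodic_mean T n f x)
      \<le> (1 - t) * S (\<lambda>x. ergodic_mean T n g x - ergodic_mean T n f x)
        + t * S (\<lambda>x. ergodic_mean T n h x - ergodic_mean T n f x)" for n
    unfolding eq by (intro convex t diff_in mean_in f g h)
  have "(\<lambda>n. (1 - t) * S (\<lambda>x. ergodic_mean T n g x - ergodic_mean T n f x)
        + t * S (\<lambda>x. ergodic_mean T n h x - ergodic_mean T n f x)) \<longlonglongrightarrow> (1 - t) * 0 + t * 0"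
    by (intro tendsto_intros g h)
  then have lim: "(\<lambda>n. (1 - t) * S (\<lambda>x. ergodic_mean T n g x - ergodic_mean T n f x)
        + t * S (\<lambda>x. ergodic_mean T n h x - ergodic_mean T n f x)) \<longlonglongrightarrow> 0" by simp
  have "(\<lambda>n. S (\<lambda>x. ergodic_mean T n k x - ergodic_mean T n f x)) \<longlonglongrightarrow> 0"
    by (rule tendsto_sandwich[OF always_eventually always_eventually tendsto_const lim])
       (auto intro!: le nonneg diff_in mean_in f k)
  then show ?thesis using k by (simp add: equi_ergodic_def k_def)
qed

lemma equi_ergodic_mean:
  assumes f: "f \<in> X" and h: "h \<in> equi_ergodic f"
  shows "ergodic_mean T (Suc n) h \<in> equi_ergodic f"
proof -
  have it: "(T ^^ k) h \<in> equi_ergodic f" for k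
    by (induction k) (auto intro: h equi_ergodic_image f)
  show ?thesis
  proof (induction n)
    case 0
    then show ?case using h by (simp add: ergodic_mean_def)
  next
    case (Suc n)
    then show ?case
      by (subst ergodic_mean_Suc) (intro equi_ergodic_convex f it, auto)
  qed
qed

text \<open>
  Birkhoff's argument. Let \<open>d\<close> be the infimum of \<open>S\<close> on \<open>equi_ergodic f\<close>, and let \<open>h\<close> be
  a nearly minimal element. All means of \<open>h\<close> lie in the same set and are nearly minimal as well,
  since \<open>T\<close> is a contraction; so are their midpoints, which therefore have a small convexity
  defect. By uniform convexity the means of \<open>h\<close> are close to each other, and those of \<open>f\<close> are
  asymptotic to them.
\<close>

theorem ergodic_means_Cauchy:
  assumes f: "f \<in> X" and "0 < \<epsilon>"
  shows "\<exists>N. \<forall>m\<ge>N. \<forall>n\<ge>N. S (\<lambda>x. ergodic_mean T m f x - ergodic_mean T n f x) \<le> \<epsilon>"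
proof -
  define d where "d = Inf (S ` equi_ergodic f)"
  have bdd: "bdd_below (S ` equi_ergodic f)"
    by (intro bdd_belowI2[of _ 0] nonneg equi_ergodic_in)
  have d_le: "d \<le> S h" if "h \<in> equi_ergodic f" for h
    unfolding d_def using that bdd by (intro cInf_lower) auto
  have "0 \<le> d" unfolding d_def
    using equi_ergodic_self[OF f] by (intro cInf_greatest) (auto intro: nonneg equi_ergodic_in)
  \<comment> \<open>The factor \<open>3 * 4 powr p\<close> is the cost of two applications of the triangle inequality at the end.\<close>
  define \<eta> where "\<eta> = \<epsilon> / (3 * 4 powr p)"
  have "0 < \<eta>" using \<open>0 < \<epsilon>\<close> by (simp add: \<eta>_def)
  \<comment> \<open>Now \<open>\<eta>'\<close> and \<open>\<delta>\<close> are chosen so that both terms of the uniform convexity inequality are at most \<open>\<eta> / 2\<close>.\<close>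
  define \<eta>' where "\<eta>' = \<eta> / (2 * (2 * (d + 1)))"
  have "0 < \<eta>'" using \<open>0 < \<eta>\<close> \<open>0 \<le> d\<close> by (simp add: \<eta>'_def)
  have \<eta>'_half: "\<eta>' * (2 * (d + 1)) = \<eta> / 2" using \<open>0 \<le> d\<close> by (simp add: \<eta>'_def field_simps)
  obtain C where C: "0 \<le> C" "\<And>f g. f \<in> X \<Longrightarrow> g \<in> X \<Longrightarrow>
        S (\<lambda>x. f x - g x) \<le> \<eta>' * (S f + S g) + C * ((S f + S g) / 2 - S (\<lambda>x. (f x + g x) / 2))"
    using uniform[OF \<open>0 < \<eta>'\<close>] by blast
  define \<delta> where "\<delta> = min 1 (\<eta> / (2 * (C + 1)))"
  have "0 < \<delta>" using \<open>0 < \<eta>\<close> \<open>0 \<le> C\<close> by (simp add: \<delta>_def)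
  have "C * \<delta> \<le> (C + 1) * (\<eta> / (2 * (C + 1)))"
    using \<open>0 \<le> C\<close> \<open>0 < \<delta>\<close> by (intro mult_mono) (auto simp: \<delta>_def)
  also have "\<dots> = \<eta> / 2" using \<open>0 \<le> C\<close> by (simp add: field_simps)
  finally have C\<delta>: "C * \<delta> \<le> \<eta> / 2" .
  have "\<exists>y\<in>S ` equi_ergodic f. y < d + \<delta>"
    unfolding d_def using equi_ergodic_self[OF f] \<open>0 < \<delta>\<close> bdd
    by (subst cInf_less_iff[symmetric]) auto
  then obtain h where h: "h \<in> equi_ergodic f" "S h < d + \<delta>" by blast
  then have hX: "h \<in> X" by (simp add: equi_ergodic_in)
  have core: "S (\<lambda>x. ergodic_mean T (Suc m) h x - ergodic_mean T (Suc n) h x) \<le> \<eta>" for m n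
  proof -
    define u where "u = ergodic_mean T (Suc m) h"
    define v where "v = ergodic_mean T (Suc n) h"
    have uv: "u \<in> equi_ergodic f" "v \<in> equi_ergodic f"
      unfolding u_def v_def by (rule equi_ergodic_mean[OF f h(1)])+
    define M where "M = S (\<lambda>x. (u x + v x) / 2)"
    have "d \<le> M" unfolding M_def
      using d_le[OF equi_ergodic_convex[OF f uv, of "1/2"]] by (simp add: add_divide_distrib)
    moreover have le: "S u \<le> d + \<delta>" "S v \<le> d + \<delta>"
      using S_mean_le[OF hX] h(2) unfolding u_def v_def by (auto intro: order_trans less_imp_le)
    ultimately have "(S u + S v) / 2 - M \<le> \<delta>" by argo
    then have "C * ((S u + S v) / 2 - M) \<le> C * \<delta>"
      using \<open>0 \<le> C\<close> by (rule mult_left_mono)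
    moreover have "S u + S v \<le> 2 * (d + 1)" using le by (auto simp: \<delta>_def)
    then have "\<eta>' * (S u + S v) \<le> \<eta>' * (2 * (d + 1))"
      using \<open>0 < \<eta>'\<close> by (intro mult_left_mono) auto
    then have "\<eta>' * (S u + S v) \<le> \<eta> / 2" using \<eta>'_half by simp
    ultimately show ?thesis
      using C(2)[of u v] uv C\<delta> unfolding u_def[symmetric] v_def[symmetric] M_def
      by (simp add: equi_ergodic_in)
  qed
  have "\<forall>\<^sub>F n in sequentially. S (\<lambda>x. ergodic_mean T n h x - ergodic_mean T n f x) < \<eta>"
    using h(1) \<open>0 < \<eta>\<close> by (auto simp: equi_ergodic_def intro: order_tendstoD(2))
  then obtain N where N: "\<And>n. n \<ge> N \<Longrightarrow> S (\<lambda>x. ergodic_mean T n h x - ergodic_mean T n f x) < \<eta>"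
    by (auto simp: eventually_sequentially)
  have two: "1 \<le> 2 powr p" "2 powr p * 2 powr p = 4 powr p" using p
    by (auto simp flip: powr_mult intro: ge_one_powr_ge_zero)
  show ?thesis
  proof (intro exI[of _ "Suc N"] allI impI)
    fix m n assume mn: "Suc N \<le> m" "Suc N \<le> n"
    let ?A = "ergodic_mean T"
    have mh: "S (\<lambda>x. ?A m h x - ?A n h x) \<le> \<eta>"
      using core[of "m - 1" "n - 1"] mn by simp
    have mid: "S (\<lambda>x. ?A m h x - ?A n f x) \<le> 2 powr p * (\<eta> + \<eta>)"
      using S_diff_triangle[OF mean_in[OF hX] mean_in[OF hX] mean_in[OF f], of m n n] mh N[of n] mn
      by (smt (verit) Suc_leD mult_left_mono powr_ge_zero)
    have "S (\<lambda>x. ?A m f x - ?A n f x) \<le> 2 powr p * (S (\<lambda>x. ?A m f x - ?A m h x) + S (\<lambda>x. ?A m h x - ?A n f x))"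
      by (intro S_diff_triangle mean_in f hX)
    also have "\<dots> \<le> 2 powr p * (2 powr p * \<eta> + 2 powr p * (\<eta> + \<eta>))"
    proof (intro mult_left_mono add_mono mid)
      have "S (\<lambda>x. ?A m f x - ?A m h x) \<le> 1 * \<eta>"
        using N[of m] mn S_diff_commute[OF mean_in[OF f] mean_in[OF hX]] by simp
      also have "\<dots> \<le> 2 powr p * \<eta>" using two \<open>0 < \<eta>\<close> by (intro mult_right_mono) auto
      finally show "S (\<lambda>x. ?A m f x - ?A m h x) \<le> 2 powr p * \<eta>" .
    qed auto
    also have "\<dots> = 4 powr p * (3 * \<eta>)" unfolding two(2)[symmetric] by (simp add: algebra_simps)
    also have "\<dots> = \<epsilon>" by (simp add: \<eta>_def)
    finally show "S (\<lambda>x. ?A m f x - ?A n f x) \<le> \<epsilon>" .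
  qed
qed

end

section \<open>Bounded operators on the Hardy space\<close>

lemma hardy_space_iff: "f \<in> hardy_space p \<longleftrightarrow> f \<in> hardy_class p \<and> (\<forall>z. z \<notin> unit_disc \<longrightarrow> f z = 0)"
  by (auto simp: hardy_space_def hardy_class_def)

lemma hardy_space_outside: "f \<in> hardy_space p \<Longrightarrow> z \<notin> unit_disc \<Longrightarrow> f z = 0"
  by (simp add: hardy_space_iff)

lemma hardy_space_class: "f \<in> hardy_space p \<Longrightarrow> f \<in> hardy_class p"
  by (simp add: hardy_space_iff)

lemma hardy_norm_eq: "hardy_norm p f = hardy_sup p f powr (1 / p)"
  by (simp add: hardy_norm_def hardy_sup_def)

lemma hardy_space_lincomb:
  "1 < p \<Longrightarrow> f \<in> hardy_space p \<Longrightarrow> g \<in> hardy_space p \<Longrightarrow> (\<lambda>z. c * f z + d * g z) \<in> hardy_space p"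
  by (auto simp: hardy_space_iff hardy_class_lincomb)

lemma hardy_space_restrict:
  assumes "f \<in> hardy_class p"
  shows "(\<lambda>z. if z \<in> unit_disc then f z else 0) \<in> hardy_space p"
  using hardy_class_cong[OF _ assms] by (auto simp: hardy_space_iff)

lemma zero_in_hardy_space: "(\<lambda>z. 0) \<in> hardy_space p"
  by (auto simp: hardy_space_iff hardy_mean_const intro!: hardy_classI[of _ p 0])

lemma identity_function_in_hardy_space:
  assumes "1 < p"
  shows "(\<lambda>z. if z \<in> unit_disc then z else 0) \<in> hardy_space p"
proof (intro hardy_space_restrict hardy_classI)
  fix r :: real assume "0 < r" "r < 1"
  then have "norm (of_real r * cis t) powr p \<le> 1" for t
    using assms powr_mono2[of p r 1] by (simp add: norm_mult)
  then show "hardy_mean p (\<lambda>z. z) r \<le> 2 * pi"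
    using has_integral_le[OF hardy_mean_has_integral[OF assms \<open>0 < r\<close> \<open>r < 1\<close>, of "\<lambda>z. z"]
        has_integral_const_real[of 1 0 "2 * pi"]] by simp
qed auto

lemma bounded_operatorD:
  assumes "A \<in> bounded_operators (hardy_space p) (hardy_norm p)"
  shows "f \<in> hardy_space p \<Longrightarrow> A f \<in> hardy_space p"
    and "f \<notin> hardy_space p \<Longrightarrow> A f = (\<lambda>z. 0)"
    and "A (\<lambda>z. 0) = (\<lambda>z. 0)"
proof -
  have "A (\<lambda>x. c * f x) = (\<lambda>x. c * A f x)" if "f \<in> hardy_space p" for c f
    using assms that unfolding bounded_operators_def by blast
  from this[OF zero_in_hardy_space, of 0] show "A (\<lambda>z. 0) = (\<lambda>z. 0)" by simp
qed (use assms in \<open>auto simp: bounded_operators_def zero_fun_def\<close>)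

lemma bounded_operator_lincomb:
  assumes p: "1 < p" and A: "A \<in> bounded_operators (hardy_space p) (hardy_norm p)"
    and f: "f \<in> hardy_space p" and g: "g \<in> hardy_space p"
  shows "A (\<lambda>z. c * f z + d * g z) = (\<lambda>z. c * A f z + d * A g z)"
proof -
  have scaled: "(\<lambda>z. c * f z) \<in> hardy_space p" "(\<lambda>z. d * g z) \<in> hardy_space p"
    using hardy_space_lincomb[OF p f f, of c 0] hardy_space_lincomb[OF p g g, of d 0] by simp_all
  have "A ((\<lambda>z. c * f z) + (\<lambda>z. d * g z)) = A (\<lambda>z. c * f z) + A (\<lambda>z. d * g z)"
    using A scaled unfolding bounded_operators_def by blast
  also have "\<dots> = (\<lambda>z. c * A f z) + (\<lambda>z. d * A g z)"
    using A f g unfolding bounded_operators_def by auto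
  finally show ?thesis by (simp add: plus_fun_def)
qed

text \<open>
  Boundedness is used and established through \<open>p\<close>-th powers of norms.
\<close>

lemma bounded_operator_hardy_sup:
  assumes p: "1 < p" and A: "A \<in> bounded_operators (hardy_space p) (hardy_norm p)"
  obtains C where "0 \<le> C" "\<And>f. f \<in> hardy_space p \<Longrightarrow> hardy_sup p (A f) \<le> C * hardy_sup p f"
proof -
  obtain K where K: "\<And>f. f \<in> hardy_space p \<Longrightarrow> hardy_norm p (A f) \<le> K * hardy_norm p f"
    using A unfolding bounded_operators_def by blast
  show thesis
  proof (rule that[of "\<bar>K\<bar> powr p"])
    fix f assume f: "f \<in> hardy_space p"
    have nn: "0 \<le> hardy_sup p f" "0 \<le> hardy_sup p (A f)"
      using f bounded_operatorD(1)[OF A f] hardy_sup_nonneg[OF p] by (auto simp: hardy_space_iff)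
    have "hardy_sup p (A f) powr (1 / p) \<le> K * hardy_sup p f powr (1 / p)"
      using K[OF f] by (simp add: hardy_norm_eq)
    also have "\<dots> \<le> \<bar>K\<bar> * hardy_sup p f powr (1 / p)" by (intro mult_right_mono) auto
    finally have "(hardy_sup p (A f) powr (1 / p)) powr p \<le> (\<bar>K\<bar> * hardy_sup p f powr (1 / p)) powr p"
      using p by (intro powr_mono2) auto
    then show "hardy_sup p (A f) \<le> \<bar>K\<bar> powr p * hardy_sup p f"
      using p nn by (simp add: powr_mult powr_powr)
  qed auto
qed

lemma bounded_operatorI:
  assumes p: "1 < p" and "\<And>f. f \<in> hardy_space p \<Longrightarrow> A f \<in> hardy_space p"
    and "\<And>f. f \<notin> hardy_space p \<Longrightarrow> A f = (\<lambda>z. 0)"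
    and lin: "\<And>f g c d. f \<in> hardy_space p \<Longrightarrow> g \<in> hardy_space p \<Longrightarrow>
      A (\<lambda>z. c * f z + d * g z) = (\<lambda>z. c * A f z + d * A g z)"
    and le: "\<And>f. f \<in> hardy_space p \<Longrightarrow> hardy_sup p (A f) \<le> C * hardy_sup p f"
  shows "A \<in> bounded_operators (hardy_space p) (hardy_norm p)"
proof -
  have "hardy_norm p (A f) \<le> \<bar>C\<bar> powr (1 / p) * hardy_norm p f" if f: "f \<in> hardy_space p" for f
  proof -
    have nn: "0 \<le> hardy_sup p f" "0 \<le> hardy_sup p (A f)"
      using f assms(2)[OF f] hardy_sup_nonneg[OF p] by (auto simp: hardy_space_iff)
    have "hardy_sup p (A f) \<le> \<bar>C\<bar> * hardy_sup p f"
      by (rule order_trans[OF le[OF f] mult_right_mono[OF abs_ge_self nn(1)]])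
    then have "hardy_sup p (A f) powr (1 / p) \<le> (\<bar>C\<bar> * hardy_sup p f) powr (1 / p)"
      using p nn by (intro powr_mono2) auto
    then show ?thesis using nn by (simp add: hardy_norm_eq powr_mult)
  qed
  moreover have "A (f + g) = A f + A g" if "f \<in> hardy_space p" "g \<in> hardy_space p" for f g
    using lin[OF that, of 1 1] by (simp add: plus_fun_def)
  moreover have "A (\<lambda>z. c * f z) = (\<lambda>z. c * A f z)" if "f \<in> hardy_space p" for c f
    using lin[OF that that, of c 0] by simp
  ultimately show ?thesis
    using assms(2,3) unfolding bounded_operators_def by (auto simp: zero_fun_def)
qed

lemma composition_operator_apply:
  "f \<in> hardy_space p \<Longrightarrow> z \<in> unit_disc \<Longrightarrow> composition_operator p \<phi> f z = f (\<phi> z)"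
  by (simp add: composition_operator_def)

lemma composition_operator_in:
  assumes "1 < p" "\<phi> holomorphic_on unit_disc" "\<phi> ` unit_disc \<subseteq> unit_disc" "f \<in> hardy_space p"
  shows "composition_operator p \<phi> f \<in> hardy_space p"
  using hardy_space_restrict[OF hardy_class_compose[OF assms(1) _ assms(2,3)], of f] assms(4)
  by (simp add: composition_operator_def hardy_space_iff)

lemma composition_operator_lincomb:
  assumes "1 < p" "f \<in> hardy_space p" "g \<in> hardy_space p"
  shows "composition_operator p \<phi> (\<lambda>z. c * f z + d * g z)
    = (\<lambda>z. c * composition_operator p \<phi> f z + d * composition_operator p \<phi> g z)"
  using assms hardy_space_lincomb[OF assms] by (auto simp: composition_operator_def)

lemma composition_operator_bounded:
  assumes "1 < p" "\<phi> holomorphic_on unit_disc" "\<phi> ` unit_disc \<subseteq> unit_disc"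
  shows "composition_operator p \<phi> \<in> bounded_operators (hardy_space p) (hardy_norm p)"
proof (rule bounded_operatorI[OF assms(1)])
  show "hardy_sup p (composition_operator p \<phi> f) \<le> (1 + norm (\<phi> 0)) / (1 - norm (\<phi> 0)) * hardy_sup p f"
    if "f \<in> hardy_space p" for f
    using hardy_sup_compose_le[OF assms(1) _ assms(2,3), of f] that
      hardy_sup_cong[of "composition_operator p \<phi> f" "\<lambda>z. f (\<phi> z)" p]
    by (simp add: composition_operator_apply hardy_space_iff)
qed (auto simp: composition_operator_in[OF assms] composition_operator_lincomb[OF assms(1)],
     simp add: composition_operator_def zero_fun_def)

lemma identity_operator_bounded:
  assumes "1 < p"
  shows "identity_operator (hardy_space p) \<in> bounded_operators (hardy_space p) (hardy_norm p)"
  by (rule bounded_operatorI[OF assms, of _ 1])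
     (auto simp: identity_operator_def hardy_space_lincomb[OF assms] zero_fun_def)

lemma bounded_operator_comp_identity:
  assumes "A \<in> bounded_operators (hardy_space p) (hardy_norm p)"
  shows "A \<circ> identity_operator (hardy_space p) = A" "identity_operator (hardy_space p) \<circ> A = A"
  using bounded_operatorD[OF assms] by (auto simp: identity_operator_def fun_eq_iff zero_fun_def)

lemma commutant_iff: "A \<in> commutant X N T \<longleftrightarrow> A \<in> bounded_operators X N \<and> A \<circ> T = T \<circ> A"
  by (simp add: commutant_def)

lemma identity_in_bicommutant:
  assumes "1 < p"
  shows "identity_operator (hardy_space p) \<in> bicommutant (hardy_space p) (hardy_norm p) T"
  unfolding bicommutant_def
  by (auto simp: commutant_iff identity_operator_bounded[OF assms] bounded_operator_comp_identity)

lemma bicommutant_subset_commutant: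
  "T \<in> bounded_operators X N \<Longrightarrow> bicommutant X N T \<subseteq> commutant X N T"
  unfolding bicommutant_def commutant_def by auto

lemma point_evaluation_bounded:
  assumes "1 < p" "w \<in> unit_disc"
  shows "(\<lambda>f z. if f \<in> hardy_space p \<and> z \<in> unit_disc then f w else 0)
           \<in> bounded_operators (hardy_space p) (hardy_norm p)" (is "?E \<in> _")
proof (rule bounded_operatorI[OF assms(1)])
  fix f assume f: "f \<in> hardy_space p"
  have c: "(\<lambda>_. w) holomorphic_on unit_disc" "(\<lambda>_. w) ` unit_disc \<subseteq> unit_disc" using assms by auto
  have f': "f \<in> hardy_class p" using f by (simp add: hardy_space_iff)
  show "?E f \<in> hardy_space p"
    using hardy_space_restrict[OF hardy_class_compose[OF assms(1) f' c]] f by simp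
  show "hardy_sup p (?E f) \<le> (1 + norm w) / (1 - norm w) * hardy_sup p f"
    using hardy_sup_compose_le[OF assms(1) f' c] f hardy_sup_cong[of "?E f" "\<lambda>_. f w" p] by simp
qed (auto simp: hardy_space_lincomb[OF assms(1)])

text \<open>
  The rank-one operators that send \<open>f\<close> to the constant \<open>f w\<close>, for two different points \<open>w\<close>.
\<close>

lemma hardy_bounded_operators_noncommutative:
  assumes "1 < p"
  obtains A B where "A \<in> bounded_operators (hardy_space p) (hardy_norm p)"
    "B \<in> bounded_operators (hardy_space p) (hardy_norm p)" "A \<circ> B \<noteq> B \<circ> A"
proof -
  define E where "E = (\<lambda>w f z. if f \<in> hardy_space p \<and> z \<in> unit_disc then f w else (0::complex))"
  have E: "E w \<in> bounded_operators (hardy_space p) (hardy_norm p)" if "w \<in> unit_disc" for w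
    unfolding E_def by (rule point_evaluation_bounded[OF assms that])
  define f :: "complex \<Rightarrow> complex" where "f = (\<lambda>z. if z \<in> unit_disc then z else 0)"
  have f: "f \<in> hardy_space p" unfolding f_def by (rule identity_function_in_hardy_space[OF assms])
  have Ef: "E w f \<in> hardy_space p" if "w \<in> unit_disc" for w
    using bounded_operatorD(1)[OF E[OF that] f] .
  have "(E 0 \<circ> E (1/2)) f 0 = 1/2" "(E (1/2) \<circ> E 0) f 0 = 0"
    using f Ef[of 0] Ef[of "1/2"] by (simp_all add: E_def[abs_def] f_def)
  then have "(E 0 \<circ> E (1/2)) f 0 \<noteq> (E (1/2) \<circ> E 0) f 0"
    by (metis zero_neq_one divide_eq_0_iff zero_neq_numeral)
  then have "E 0 \<circ> E (1/2) \<noteq> E (1/2) \<circ> E 0" by metis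
  then show thesis by (intro that[OF E E]) auto
qed

section \<open>The ergodic projection of a composition operator\<close>

text \<open>
  The abstract ergodic theorem is applied with \<open>S f = hardy_sup p (f \<circ> g)\<close>, where \<open>g\<close> is an automorphism of
  the disc with \<open>g 0 = a\<close> and inverse \<open>h\<close>. The conjugate \<open>h \<circ> \<phi> \<circ> g\<close> fixes \<open>0\<close>, so composition with \<open>\<phi>\<close> is a
  contraction for \<open>S\<close>. Subordination for \<open>g\<close> and for \<open>h\<close> shows that \<open>S\<close> and \<open>hardy_sup p\<close> are
  comparable, which carries the conclusions over to the norm of the Hardy space.
\<close>

theorem mean_ergodic_composition_operator:
  assumes p: "1 < p" and \<phi>: "\<phi> holomorphic_on unit_disc" and sub: "\<phi> ` unit_disc \<subseteq> unit_disc"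
    and a: "a \<in> unit_disc" "\<phi> a = a"
  obtains C where "0 \<le> C"
    "\<And>n f. f \<in> hardy_space p \<Longrightarrow> ergodic_mean (composition_operator p \<phi>) n f \<in> hardy_space p"
    "\<And>n f. f \<in> hardy_space p \<Longrightarrow> hardy_sup p (ergodic_mean (composition_operator p \<phi>) n f) \<le> C * hardy_sup p f"
    "\<And>n f g c d. f \<in> hardy_space p \<Longrightarrow> g \<in> hardy_space p \<Longrightarrow>
       ergodic_mean (composition_operator p \<phi>) n (\<lambda>z. c * f z + d * g z)
         = (\<lambda>z. c * ergodic_mean (composition_operator p \<phi>) n f z + d * ergodic_mean (composition_operator p \<phi>) n g z)"
    "\<And>f. f \<in> hardy_space p \<Longrightarrow> \<exists>h\<in>hardy_space p.
       (\<lambda>n. hardy_sup p (\<lambda>z. ergodic_mean (composition_operator p \<phi>) n f z - h z)) \<longlonglongrightarrow> 0"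
    "\<And>f z. f \<in> hardy_space p \<Longrightarrow> z \<in> unit_disc \<Longrightarrow>
       (\<lambda>n. ergodic_mean (composition_operator p \<phi>) n (composition_operator p \<phi> f) z
          - ergodic_mean (composition_operator p \<phi>) n f z) \<longlonglongrightarrow> 0"
proof -
  define T where "T = composition_operator p \<phi>"
  obtain h g where hg: "h a = 0" "h holomorphic_on unit_disc" "h ` unit_disc \<subseteq> unit_disc"
      "g holomorphic_on unit_disc" "g ` unit_disc \<subseteq> unit_disc"
      "\<And>z. z \<in> unit_disc \<Longrightarrow> h (g z) = z" "\<And>z. z \<in> unit_disc \<Longrightarrow> g (h z) = z"
    using ball_biholomorphism_exists[OF a(1)] by blast
  \<comment> \<open>The \<open>p\<close>-th power of a norm for which composition with \<open>\<phi>\<close> is a contraction.\<close>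
  define S where "S = (\<lambda>f. hardy_sup p (\<lambda>z. f (g z)))"
  have g_disc: "g z \<in> unit_disc" and h_disc: "h z \<in> unit_disc" and \<phi>_disc: "\<phi> z \<in> unit_disc"
    if "z \<in> unit_disc" for z
    using that hg(3,5) sub by blast+
  have "g 0 = a" using hg(7)[OF a(1)] hg(1) by simp
  have fg: "(\<lambda>z. f (g z)) \<in> hardy_class p" if "f \<in> hardy_space p" for f
    using that by (intro hardy_class_compose[OF p _ hg(4,5)] hardy_space_class)
  define c where "c = (1 + norm (g 0)) / (1 - norm (g 0))"
  define c' where "c' = (1 + norm (h 0)) / (1 - norm (h 0))"
  have "0 \<le> c" "0 \<le> c'"
    using g_disc[of 0] h_disc[of 0] by (auto simp: c_def c'_def)
  have S_le: "S f \<le> c * hardy_sup p f" if "f \<in> hardy_space p" for f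
    unfolding S_def c_def using that by (intro hardy_sup_compose_le[OF p _ hg(4,5)] hardy_space_class)
  have le_S: "hardy_sup p f \<le> c' * S f" if "f \<in> hardy_space p" for f
  proof -
    have "hardy_sup p f = hardy_sup p (\<lambda>z. f (g (h z)))"
      using hg(7) by (intro hardy_sup_cong) simp
    then show ?thesis
      unfolding S_def c'_def using hardy_sup_compose_le[OF p fg[OF that] hg(2,3)] by simp
  qed
  interpret uniformly_convex_contraction "hardy_space p" S p T
  proof
    show "S (\<lambda>x. c * f x) = norm c powr p * S f" if "f \<in> hardy_space p" for f c
      unfolding S_def by (rule hardy_sup_scale[OF p fg[OF that]])
    show "S (\<lambda>x. of_real (1 - t) * f x + of_real t * g x) \<le> (1 - t) * S f + t * S g"
      if "f \<in> hardy_space p" "g \<in> hardy_space p" "0 \<le> t" "t \<le> 1" for f g t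
      unfolding S_def by (rule hardy_sup_convex_combination[OF p fg[OF that(1)] fg[OF that(2)] that(3,4)])
    fix \<epsilon> :: real assume "0 < \<epsilon>"
    from hardy_sup_uniformly_convex[OF p this] obtain C where C: "0 \<le> C"
      "\<And>f g. f \<in> hardy_class p \<Longrightarrow> g \<in> hardy_class p \<Longrightarrow>
       hardy_sup p (\<lambda>z. f z - g z) \<le> \<epsilon> * (hardy_sup p f + hardy_sup p g)
         + C * ((hardy_sup p f + hardy_sup p g) / 2 - hardy_sup p (\<lambda>z. (f z + g z) / 2))" by blast
    show "\<exists>C\<ge>0. \<forall>f\<in>hardy_space p. \<forall>g\<in>hardy_space p.
        S (\<lambda>x. f x - g x) \<le> \<epsilon> * (S f + S g) + C * ((S f + S g) / 2 - S (\<lambda>x. (f x + g x) / 2))"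
      unfolding S_def using C(2)[OF fg fg] \<open>0 \<le> C\<close> by blast
  next
    show "S (T f) \<le> S f" if f: "f \<in> hardy_space p" for f
    proof -
      define \<psi> where "\<psi> = (\<lambda>z. h (\<phi> (g z)))"
      have "(\<lambda>z. \<phi> (g z)) holomorphic_on unit_disc"
        using holomorphic_on_compose_gen[OF hg(4) \<phi> hg(5)] by (simp add: o_def)
      then have \<psi>: "\<psi> holomorphic_on unit_disc" unfolding \<psi>_def
        using holomorphic_on_compose_gen[of "\<lambda>z. \<phi> (g z)" unit_disc h unit_disc] hg(2) g_disc \<phi>_disc
        by (simp add: o_def image_subset_iff)
      have \<psi>_sub: "\<psi> ` unit_disc \<subseteq> unit_disc" unfolding \<psi>_def using g_disc \<phi>_disc h_disc by blast
      have "\<psi> 0 = 0" by (simp add: \<psi>_def \<open>g 0 = a\<close> a hg(1))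
      have "S (T f) = hardy_sup p (\<lambda>z. f (g (\<psi> z)))" unfolding S_def T_def
        using g_disc \<phi>_disc hg(7) by (intro hardy_sup_cong) (simp add: composition_operator_apply[OF f] \<psi>_def)
      also have "\<dots> \<le> (1 + norm (\<psi> 0)) / (1 - norm (\<psi> 0)) * S f"
        unfolding S_def by (rule hardy_sup_compose_le[OF p fg[OF f] \<psi> \<psi>_sub])
      finally show ?thesis by (simp add: \<open>\<psi> 0 = 0\<close>)
    qed
    show "0 \<le> S f" if "f \<in> hardy_space p" for f
      unfolding S_def by (rule hardy_sup_nonneg[OF p fg[OF that]])
  qed (use p in \<open>auto simp: T_def hardy_space_lincomb composition_operator_in[OF p \<phi> sub] composition_operator_lincomb\<close>)
  show thesis
  proof (rule that[of "c' * c"]; (fold T_def)?)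
    show "0 \<le> c' * c" using \<open>0 \<le> c\<close> \<open>0 \<le> c'\<close> by simp
    show "ergodic_mean T n f \<in> hardy_space p" if "f \<in> hardy_space p" for f n by (rule mean_in[OF that])
    show "ergodic_mean T n (\<lambda>z. c * f z + d * g z) = (\<lambda>z. c * ergodic_mean T n f z + d * ergodic_mean T n g z)"
      if "f \<in> hardy_space p" "g \<in> hardy_space p" for f g n c d by (rule mean_lincomb[OF that])
    fix f assume f: "f \<in> hardy_space p"
    show "hardy_sup p (ergodic_mean T n f) \<le> c' * c * hardy_sup p f" for n
    proof -
      have "hardy_sup p (ergodic_mean T n f) \<le> c' * S (ergodic_mean T n f)" by (rule le_S[OF mean_in[OF f]])
      also have "\<dots> \<le> c' * (c * hardy_sup p f)"
        using S_mean_le[OF f, of n] S_le[OF f] \<open>0 \<le> c'\<close> by (intro mult_left_mono) auto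
      finally show ?thesis by simp
    qed
    show "\<exists>h\<in>hardy_space p. (\<lambda>n. hardy_sup p (\<lambda>z. ergodic_mean T n f z - h z)) \<longlonglongrightarrow> 0"
    proof -
      have "\<exists>N. \<forall>m\<ge>N. \<forall>n\<ge>N. hardy_sup p (\<lambda>z. ergodic_mean T m f z - ergodic_mean T n f z) \<le> \<epsilon>"
        if "0 < \<epsilon>" for \<epsilon>
      proof -
        have "0 < \<epsilon> / (c' + 1)" using that \<open>0 \<le> c'\<close> by simp
        from ergodic_means_Cauchy[OF f this] obtain N where
          N: "\<And>m n. m \<ge> N \<Longrightarrow> n \<ge> N \<Longrightarrow> S (\<lambda>z. ergodic_mean T m f z - ergodic_mean T n f z) \<le> \<epsilon> / (c' + 1)"
          by blast
        have "hardy_sup p (\<lambda>z. ergodic_mean T m f z - ergodic_mean T n f z) \<le> \<epsilon>" if "m \<ge> N" "n \<ge> N" for m n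
        proof -
          have "hardy_sup p (\<lambda>z. ergodic_mean T m f z - ergodic_mean T n f z) \<le> c' * (\<epsilon> / (c' + 1))"
            by (rule order_trans[OF le_S[OF diff_in[OF mean_in[OF f] mean_in[OF f]]] mult_left_mono[OF N[OF that] \<open>0 \<le> c'\<close>]])
          also have "\<dots> \<le> \<epsilon>" using \<open>0 \<le> c'\<close> \<open>0 < \<epsilon>\<close> by (simp add: field_simps)
          finally show ?thesis .
        qed
        then show ?thesis by blast
      qed
      from hardy_class_complete[OF p hardy_space_class[OF mean_in[OF f]] this]
      obtain L where L: "L \<in> hardy_class p"
        "(\<lambda>n. hardy_sup p (\<lambda>z. ergodic_mean T n f z - L z)) \<longlonglongrightarrow> 0" by blast
      define l where "l = (\<lambda>z. if z \<in> unit_disc then L z else 0)"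
      have "l \<in> hardy_space p" unfolding l_def by (rule hardy_space_restrict[OF L(1)])
      moreover have "hardy_sup p (\<lambda>z. ergodic_mean T n f z - L z) = hardy_sup p (\<lambda>z. ergodic_mean T n f z - l z)" for n
        by (intro hardy_sup_cong) (simp add: l_def)
      then have "(\<lambda>n. hardy_sup p (\<lambda>z. ergodic_mean T n f z - l z)) \<longlonglongrightarrow> 0" using L(2) by simp
      ultimately show ?thesis by blast
    qed
    fix z :: complex assume z: "z \<in> unit_disc"
    define D where "D = (\<lambda>n z. ergodic_mean T n (T f) z - ergodic_mean T n f z)"
    have D: "D n \<in> hardy_space p" for n unfolding D_def by (intro diff_in mean_in T_in f)
    have "(\<lambda>n. S (D n)) \<longlonglongrightarrow> 0"
      using equi_ergodic_image[OF f equi_ergodic_self[OF f]] by (simp add: equi_ergodic_def D_def)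
    from tendsto_mult[OF tendsto_const this, of c'] have lim: "(\<lambda>n. c' * S (D n)) \<longlonglongrightarrow> 0" by simp
    have "(\<lambda>n. hardy_sup p (D n)) \<longlonglongrightarrow> 0"
      using le_S[OF D] hardy_sup_nonneg[OF p hardy_space_class[OF D]]
      by (intro tendsto_sandwich[OF always_eventually always_eventually tendsto_const lim]) auto
    from hardy_point_evaluation_tendsto[OF p hardy_space_class[OF D] this z]
    show "(\<lambda>n. ergodic_mean T n (T f) z - ergodic_mean T n f z) \<longlonglongrightarrow> 0" by (simp add: D_def)
  qed
qed

text \<open>
  The limit \<open>J\<close> of the ergodic means. The means commute with each \<open>B\<close> in the commutant, and norm continuity
  of \<open>B\<close> passes this to the limit. Since the means of \<open>T f\<close> and \<open>f\<close> have the same limit, \<open>J \<circ> T = J\<close>; hence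
  \<open>T \<circ> J = J\<close>, and on fixed points of \<open>T\<close> the means are constant, so \<open>J \<circ> J = J\<close>.
\<close>

theorem ergodic_projection_exists:
  assumes p: "1 < p" and \<phi>: "\<phi> holomorphic_on unit_disc" and sub: "\<phi> ` unit_disc \<subseteq> unit_disc"
    and a: "a \<in> unit_disc" "\<phi> a = a"
  obtains J where
    "J \<in> bicommutant (hardy_space p) (hardy_norm p) (composition_operator p \<phi>)"
    "J \<circ> J = J" "composition_operator p \<phi> \<circ> J = J"
    "\<And>f. f \<in> hardy_space p \<Longrightarrow> composition_operator p \<phi> f = f \<Longrightarrow> J f = f"
proof -
  let ?X = "hardy_space p" and ?N = "hardy_norm p"
  define T where "T = composition_operator p \<phi>"
  define A where "A = ergodic_mean T"
  obtain C where "0 \<le> C"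
    and A_in: "\<And>n f. f \<in> ?X \<Longrightarrow> A n f \<in> ?X"
    and A_le: "\<And>n f. f \<in> ?X \<Longrightarrow> hardy_sup p (A n f) \<le> C * hardy_sup p f"
    and A_lin: "\<And>n f g c d. f \<in> ?X \<Longrightarrow> g \<in> ?X \<Longrightarrow> A n (\<lambda>z. c * f z + d * g z) = (\<lambda>z. c * A n f z + d * A n g z)"
    and A_lim: "\<And>f. f \<in> ?X \<Longrightarrow> \<exists>h\<in>?X. (\<lambda>n. hardy_sup p (\<lambda>z. A n f z - h z)) \<longlonglongrightarrow> 0"
    and A_T: "\<And>f z. f \<in> ?X \<Longrightarrow> z \<in> unit_disc \<Longrightarrow> (\<lambda>n. A n (T f) z - A n f z) \<longlonglongrightarrow> 0"
    unfolding A_def T_def by (rule mean_ergodic_composition_operator[OF p \<phi> sub a]) blast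
  have T: "T \<in> bounded_operators ?X ?N" unfolding T_def by (rule composition_operator_bounded[OF p \<phi> sub])
  have diff: "(\<lambda>z. f z - g z) \<in> ?X" if "f \<in> ?X" "g \<in> ?X" for f g
    using hardy_space_lincomb[OF p that, of 1 "-1"] by simp
  have fun_eqI: "f = g" if "f \<in> ?X" "g \<in> ?X" "\<And>z. z \<in> unit_disc \<Longrightarrow> f z = g z" for f g
    using that by (metis ext hardy_space_outside)
  define J where "J = (\<lambda>f. if f \<in> ?X then (SOME h. h \<in> ?X \<and> (\<lambda>n. hardy_sup p (\<lambda>z. A n f z - h z)) \<longlonglongrightarrow> 0) else (\<lambda>z. 0))"
  have "J f \<in> ?X \<and> (\<lambda>n. hardy_sup p (\<lambda>z. A n f z - J f z)) \<longlonglongrightarrow> 0" if "f \<in> ?X" for f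
    using someI_ex[of "\<lambda>h. h \<in> ?X \<and> (\<lambda>n. hardy_sup p (\<lambda>z. A n f z - h z)) \<longlonglongrightarrow> 0"] A_lim[OF that] that
    unfolding J_def by auto
  then have J_in: "\<And>f. f \<in> ?X \<Longrightarrow> J f \<in> ?X"
    and J_lim: "\<And>f. f \<in> ?X \<Longrightarrow> (\<lambda>n. hardy_sup p (\<lambda>z. A n f z - J f z)) \<longlonglongrightarrow> 0" by auto
  have J_outside: "f \<notin> ?X \<Longrightarrow> J f = (\<lambda>z. 0)" for f by (simp add: J_def)
  have J_pt: "(\<lambda>n. A n f z) \<longlonglongrightarrow> J f z" if "f \<in> ?X" "z \<in> unit_disc" for f z
    using hardy_point_evaluation_tendsto[OF p hardy_space_class[OF diff[OF A_in[OF that(1)] J_in[OF that(1)]]]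
        J_lim[OF that(1)] that(2)]
    by (simp add: LIM_zero_iff)
  have J_lin: "J (\<lambda>z. c * f z + d * g z) = (\<lambda>z. c * J f z + d * J g z)" if f: "f \<in> ?X" and g: "g \<in> ?X" for f g c d
  proof (rule fun_eqI)
    fix z assume z: "z \<in> unit_disc"
    have "(\<lambda>n. A n (\<lambda>z. c * f z + d * g z) z) \<longlonglongrightarrow> c * J f z + d * J g z"
      unfolding A_lin[OF f g] by (intro tendsto_intros J_pt f g z)
    with J_pt[OF hardy_space_lincomb[OF p f g] z]
    show "J (\<lambda>z. c * f z + d * g z) z = c * J f z + d * J g z" by (rule LIMSEQ_unique)
  qed (intro hardy_space_lincomb[OF p] J_in f g)+
  have J_le: "hardy_sup p (J f) \<le> 2 powr p * C * hardy_sup p f" if f: "f \<in> ?X" for f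
  proof (rule hardy_sup_least)
    fix r :: real assume r: "0 < r" "r < 1"
    note I = hardy_mean_has_integral[OF p r hardy_class_holomorphic[OF hardy_space_class[of _ p]]]
    have "hardy_mean p (J f) r \<le> 2 powr p * (C * hardy_sup p f + hardy_sup p (\<lambda>z. A n f z - J f z))" for n
    proof -
      have d: "(\<lambda>z. A n f z - J f z) \<in> ?X" by (intro diff A_in J_in f)
      have "hardy_mean p (J f) r \<le> 2 powr p * (hardy_mean p (A n f) r + hardy_mean p (\<lambda>z. A n f z - J f z) r)"
      proof (rule has_integral_le[OF I[OF J_in[OF f]]])
        show "((\<lambda>t. 2 powr p * (norm (A n f (of_real r * cis t)) powr p
              + norm (A n f (of_real r * cis t) - J f (of_real r * cis t)) powr p)) has_integral
            2 powr p * (hardy_mean p (A n f) r + hardy_mean p (\<lambda>z. A n f z - J f z) r)) {0..2*pi}"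
          by (intro has_integral_mult_right has_integral_add I A_in f d)
        show "norm (J f w) powr p \<le> 2 powr p * (norm (A n f w) powr p + norm (A n f w - J f w) powr p)" for w
          using norm_powr_add_le[OF p, of "A n f w" "J f w - A n f w"] by (simp add: norm_minus_commute)
      qed
      also have "\<dots> \<le> 2 powr p * (C * hardy_sup p f + hardy_sup p (\<lambda>z. A n f z - J f z))"
        using hardy_mean_le_sup[OF hardy_space_class[OF A_in[OF f]] r, of n] A_le[OF f, of n]
          hardy_mean_le_sup[OF hardy_space_class[OF d] r]
        by (intro mult_left_mono add_mono) auto
      finally show ?thesis .
    qed
    moreover have "(\<lambda>n. 2 powr p * (C * hardy_sup p f + hardy_sup p (\<lambda>z. A n f z - J f z)))
        \<longlonglongrightarrow> 2 powr p * (C * hardy_sup p f + 0)"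
      by (intro tendsto_intros J_lim f)
    ultimately have "hardy_mean p (J f) r \<le> 2 powr p * (C * hardy_sup p f + 0)"
      by (rule LIMSEQ_le_const[rotated, OF exI, OF allI, OF impI])
    then show "hardy_mean p (J f) r \<le> 2 powr p * C * hardy_sup p f" by simp
  qed
  have J_bdd: "J \<in> bounded_operators ?X ?N"
    by (rule bounded_operatorI[OF p J_in J_outside J_lin J_le])
  have J_comm: "J \<circ> B = B \<circ> J" if "B \<in> commutant ?X ?N T" for B
  proof -
    have B: "B \<in> bounded_operators ?X ?N" and "B \<circ> T = T \<circ> B" using that by (auto simp: commutant_iff)
    then have BT: "B (T f) = T (B f)" for f by (metis comp_apply)
    have B_it: "B ((T ^^ k) f) = (T ^^ k) (B f)" for k f by (induction k) (auto simp: BT)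
    have it: "(T ^^ k) f \<in> ?X" if "f \<in> ?X" for k f
      using that by (induction k) (auto intro: bounded_operatorD(1)[OF T])
    have BA: "B (A n f) = A n (B f)" if f: "f \<in> ?X" for n f
    proof (induction n)
      case 0
      then show ?case by (simp add: A_def ergodic_mean_0 bounded_operatorD(3)[OF B])
    next
      case (Suc n)
      then show ?case
        unfolding A_def ergodic_mean_Suc
        by (subst bounded_operator_lincomb[OF p B]) (simp_all add: B_it it[OF f] A_in[OF f, unfolded A_def])
    qed
    obtain K where K: "0 \<le> K" "\<And>f. f \<in> ?X \<Longrightarrow> hardy_sup p (B f) \<le> K * hardy_sup p f"
      using bounded_operator_hardy_sup[OF p B] by blast
    have "J (B f) = B (J f)" if f: "f \<in> ?X" for f
    proof (rule fun_eqI)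
      have Bf: "B f \<in> ?X" by (rule bounded_operatorD(1)[OF B f])
      show "J (B f) \<in> ?X" "B (J f) \<in> ?X" using Bf f by (auto intro: J_in bounded_operatorD(1)[OF B])
      fix z assume z: "z \<in> unit_disc"
      define D where "D = (\<lambda>n. B (\<lambda>z. A n f z - J f z))"
      have D: "D n \<in> ?X" for n unfolding D_def by (intro bounded_operatorD(1)[OF B] diff A_in J_in f)
      have D_eq: "D n = (\<lambda>z. A n (B f) z - B (J f) z)" for n
        using bounded_operator_lincomb[OF p B A_in[OF f] J_in[OF f], of 1 n "-1"] by (simp add: D_def BA[OF f])
      have lim: "(\<lambda>n. K * hardy_sup p (\<lambda>z. A n f z - J f z)) \<longlonglongrightarrow> 0"
        using tendsto_mult[OF tendsto_const J_lim[OF f], of K] by simp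
      have le: "hardy_sup p (D n) \<le> K * hardy_sup p (\<lambda>z. A n f z - J f z)" for n
        unfolding D_def by (intro K(2) diff A_in J_in f)
      have "(\<lambda>n. hardy_sup p (D n)) \<longlonglongrightarrow> 0"
        using le hardy_sup_nonneg[OF p hardy_space_class[OF D]]
        by (intro tendsto_sandwich[OF always_eventually always_eventually tendsto_const lim]) auto
      from hardy_point_evaluation_tendsto[OF p hardy_space_class[OF D] this z]
      have "(\<lambda>n. A n (B f) z) \<longlonglongrightarrow> B (J f) z" by (simp add: D_eq LIM_zero_iff)
      with J_pt[OF Bf z] show "J (B f) z = B (J f) z" by (rule LIMSEQ_unique)
    qed
    moreover have "J (B f) = B (J f)" if "f \<notin> ?X" for f
      using that bounded_operatorD(2,3)[OF B] bounded_operatorD(2,3)[OF J_bdd] by simp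
    ultimately show ?thesis by (auto simp: fun_eq_iff)
  qed
  have T_comm: "T \<in> commutant ?X ?N T" using T by (simp add: commutant_iff)
  have J_fix: "J f = f" if f: "f \<in> ?X" "T f = f" for f
  proof (rule fun_eqI[OF J_in[OF f(1)] f(1)])
    fix z assume "z \<in> unit_disc"
    have it: "(T ^^ k) f = f" for k by (induction k) (auto simp: f(2))
    have "\<forall>\<^sub>F n in sequentially. A n f z = f z"
      using eventually_gt_at_top[of 0] by eventually_elim (simp add: A_def ergodic_mean_def it)
    then have "(\<lambda>n. A n f z) \<longlonglongrightarrow> f z" by (rule tendsto_eventually)
    with J_pt[OF f(1) \<open>z \<in> unit_disc\<close>] show "J f z = f z" by (rule LIMSEQ_unique)
  qed
  have TJ: "T (J f) = J f" for f
  proof (cases "f \<in> ?X")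
    case True
    have Tf: "T f \<in> ?X" by (rule bounded_operatorD(1)[OF T True])
    have "J (T f) = J f"
    proof (rule fun_eqI[OF J_in[OF Tf] J_in[OF True]])
      fix z assume z: "z \<in> unit_disc"
      from tendsto_add[OF A_T[OF True z] J_pt[OF True z]] have "(\<lambda>n. A n (T f) z) \<longlonglongrightarrow> J f z" by simp
      with J_pt[OF Tf z] show "J (T f) z = J f z" by (rule LIMSEQ_unique)
    qed
    then show ?thesis using J_comm[OF T_comm] by (metis comp_apply)
  next
    case False
    then show ?thesis by (simp add: J_outside bounded_operatorD(3)[OF T])
  qed
  show thesis
  proof (rule that[of J]; (fold T_def)?)
    show "J \<in> bicommutant ?X ?N T"
      unfolding bicommutant_def using J_bdd J_comm by (auto simp: commutant_iff)
    show "J \<circ> J = J"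
    proof (rule ext)
      fix f
      show "(J \<circ> J) f = J f"
        using J_fix[OF J_in TJ, of f] J_outside[of f] bounded_operatorD(3)[OF J_bdd] by (cases "f \<in> ?X") simp_all
    qed
    show "T \<circ> J = J" by (rule ext) (simp add: TJ)
  qed (rule J_fix)
qed

section \<open>Idempotents and functions on connected sets\<close>

lemma connected_idempotent_function:
  assumes "connected G" "continuous_on G e" "\<And>z. z \<in> G \<Longrightarrow> e z * e z = e z"
  shows "(\<forall>z\<in>G. e z = (0::complex)) \<or> (\<forall>z\<in>G. e z = 1)"
proof -
  have vals: "e z = 0 \<or> e z = 1" if "z \<in> G" for z
    using assms(3)[OF that] by simp
  then have "e ` G \<subseteq> {0, 1}" by auto
  then have "finite (e ` G)" by (rule finite_subset) auto
  then have "e constant_on G"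
    by (rule continuous_finite_range_constant[OF assms(1,2)])
  then show ?thesis using vals by (force simp: constant_on_def)
qed

lemma algebra_isomorphism_commutative:
  assumes "subalgebra_of_continuous G \<A>" "algebra_isomorphism \<A> \<B> \<Phi>" "A \<in> \<B>" "B \<in> \<B>"
  shows "A \<circ> B = B \<circ> A"
proof -
  have "\<B> = \<Phi> ` \<A>" using assms(2) by (simp add: algebra_isomorphism_def bij_betw_def)
  then obtain f g where fg: "f \<in> \<A>" "g \<in> \<A>" "A = \<Phi> f" "B = \<Phi> g" using assms by auto
  then have "A \<circ> B = \<Phi> (f * g)" "B \<circ> A = \<Phi> (g * f)"
    using assms(2) by (simp_all add: algebra_isomorphism_def)
  then show ?thesis by (simp add: mult.commute)
qed

text \<open>
  The function \<open>e\<close> that corresponds to \<open>J\<close> is idempotent, hence 0 or 1 on all of \<open>G\<close>. In the second case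
  it is a unit of the function algebra, so that \<open>J\<close> acts as a left unit on the given algebra.
\<close>

lemma algebra_isomorphism_idempotent_trivial:
  assumes G: "connected G" and \<A>: "subalgebra_of_continuous G \<A>" and \<Phi>: "algebra_isomorphism \<A> \<B> \<Phi>"
    and J: "J \<in> \<B>" "J \<circ> J = J" and E: "E \<in> \<B>" "J \<circ> E = J"
  shows "J = 0 \<or> J = E"
proof -
  have surj: "\<B> = \<Phi> ` \<A>" and inj: "inj_on \<Phi> \<A>"
    and mult: "\<And>f g. f \<in> \<A> \<Longrightarrow> g \<in> \<A> \<Longrightarrow> \<Phi> (f * g) = \<Phi> f \<circ> \<Phi> g"
    and scale: "\<And>c f. f \<in> \<A> \<Longrightarrow> \<Phi> (\<lambda>z. c * f z) = (\<lambda>h x. c * \<Phi> f h x)"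
    using \<Phi> by (auto simp: algebra_isomorphism_def bij_betw_def)
  obtain e u where e: "e \<in> \<A>" "J = \<Phi> e" and u: "u \<in> \<A>" "E = \<Phi> u" using J E surj by auto
  have cont: "continuous_on G f" "\<And>z. z \<notin> G \<Longrightarrow> f z = 0" if "f \<in> \<A>" for f
    using \<A> that by (auto simp: subalgebra_of_continuous_def continuous_functions_def)
  have "e * e \<in> \<A>" using \<A> e by (simp add: subalgebra_of_continuous_def)
  moreover have "\<Phi> (e * e) = \<Phi> e" using mult[OF e(1) e(1)] e J by simp
  ultimately have "e * e = e" using inj e by (auto dest: inj_onD)
  then have "e z * e z = e z" for z by (metis times_fun_apply)
  from connected_idempotent_function[OF G cont(1)[OF e(1)] this]
  show ?thesis
  proof
    assume "\<forall>z\<in>G. e z = 0"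
    then have "e = (\<lambda>z. 0 * e z)" using cont(2)[OF e(1)] by auto
    then have "\<Phi> e = (\<lambda>h x. 0 * \<Phi> e h x)" using scale[OF e(1), of 0] by simp
    then show ?thesis using e by (simp add: zero_fun_def)
  next
    assume "\<forall>z\<in>G. e z = 1"
    then have "e * u = u" using cont(2)[OF u(1)] by (auto simp: fun_eq_iff)
    then have "J \<circ> E = E" using mult[OF e(1) u(1)] e u by simp
    then show ?thesis using E by simp
  qed
qed

theorem theorem4:
  fixes \<phi> :: "complex \<Rightarrow> complex" and p :: real
  assumes "1 < p"
    and "\<phi> holomorphic_on unit_disc"
    and "\<phi> ` unit_disc \<subseteq> unit_disc"
    and "\<exists>a\<in>unit_disc. \<phi> a = a"
  shows "((\<exists>z\<in>unit_disc. \<phi> z \<noteq> z) \<longrightarrow>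
            (\<exists>J\<in>bicommutant (hardy_space p) (hardy_norm p) (composition_operator p \<phi>).
               nontrivial_idempotent (hardy_space p) (hardy_norm p) J)) \<and>
         \<not> functional_commutant_property (hardy_space p) (hardy_norm p) (composition_operator p \<phi>) \<and>
         ((\<exists>z\<in>unit_disc. \<phi> z \<noteq> z) \<longrightarrow>
            \<not> functional_bicommutant_property (hardy_space p) (hardy_norm p) (composition_operator p \<phi>))"
proof -
  let ?X = "hardy_space p" and ?N = "hardy_norm p" and ?T = "composition_operator p \<phi>"
  let ?I = "identity_operator (hardy_space p)"
  have T: "?T \<in> bounded_operators ?X ?N" by (rule composition_operator_bounded[OF assms(1-3)])
  have sub: "bicommutant ?X ?N ?T \<subseteq> commutant ?X ?N ?T" by (rule bicommutant_subset_commutant[OF T])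
  have I: "?I \<in> bicommutant ?X ?N ?T" by (rule identity_in_bicommutant[OF assms(1)])
  show ?thesis
  proof (cases "\<exists>z\<in>unit_disc. \<phi> z \<noteq> z")
    case True
    then obtain w where w: "w \<in> unit_disc" "\<phi> w \<noteq> w" by blast
    obtain a where a: "a \<in> unit_disc" "\<phi> a = a" using assms(4) by blast
    obtain J where J: "J \<in> bicommutant ?X ?N ?T" "J \<circ> J = J" "?T \<circ> J = J"
      "\<And>f. f \<in> ?X \<Longrightarrow> ?T f = f \<Longrightarrow> J f = f"
      using ergodic_projection_exists[OF assms(1-3) a] by blast
    have Jb: "J \<in> bounded_operators ?X ?N" using J(1) sub by (auto simp: commutant_iff)
    define u :: "complex \<Rightarrow> complex" where "u = (\<lambda>z. if z \<in> unit_disc then 1 else 0)"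
    have u: "u \<in> ?X" unfolding u_def
      by (rule hardy_space_restrict, rule hardy_classI[of _ p "2 * pi"]) (auto simp: hardy_mean_const)
    have "?T u = u" using u assms(3) by (auto simp: composition_operator_def u_def fun_eq_iff image_subset_iff)
    then have "J u = u" using J(4) u by blast
    then have "J u 0 = 1" by (simp add: u_def)
    then have "J \<noteq> 0" by (metis zero_fun_apply zero_neq_one)
    have "J \<noteq> ?I"
    proof
      assume "J = ?I"
      define v :: "complex \<Rightarrow> complex" where "v = (\<lambda>z. if z \<in> unit_disc then z else 0)"
      have v: "v \<in> ?X" unfolding v_def by (rule identity_function_in_hardy_space[OF assms(1)])
      then have "J v = v" by (simp add: \<open>J = ?I\<close> identity_operator_def)
      then have "?T v = v" using fun_cong[OF J(3), of v] by simp
      then have "v (\<phi> w) = v w" using composition_operator_apply[OF v w(1), of \<phi>] by simp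
      then show False using w assms(3) by (auto simp: v_def image_subset_iff)
    qed
    have no_iso: "\<not> (subalgebra_of_continuous G \<A> \<and> algebra_isomorphism \<A> \<B> \<Phi>)"
      if "connected G" "J \<in> \<B>" "?I \<in> \<B>" for G \<A> \<B> \<Phi>
      using algebra_isomorphism_idempotent_trivial[OF that(1) _ _ that(2) J(2) that(3)]
        bounded_operator_comp_identity(1)[OF Jb] \<open>J \<noteq> 0\<close> \<open>J \<noteq> ?I\<close> by blast
    have "nontrivial_idempotent ?X ?N J"
      using Jb J(2) \<open>J \<noteq> 0\<close> \<open>J \<noteq> ?I\<close> by (simp add: nontrivial_idempotent_def)
    moreover have "\<not> functional_commutant_property ?X ?N ?T"
      unfolding functional_commutant_property_def using no_iso J(1) I sub by blast
    moreover have "\<not> functional_bicommutant_property ?X ?N ?T"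
      unfolding functional_bicommutant_property_def using no_iso J(1) I by blast
    ultimately show ?thesis using J(1) by blast
  next
    case False
    then have "?T = ?I"
      by (auto simp: composition_operator_def identity_operator_def hardy_space_outside fun_eq_iff)
    then have "commutant ?X ?N ?T = bounded_operators ?X ?N"
      by (auto simp: commutant_iff bounded_operator_comp_identity)
    moreover obtain A B where "A \<in> bounded_operators ?X ?N" "B \<in> bounded_operators ?X ?N" "A \<circ> B \<noteq> B \<circ> A"
      using hardy_bounded_operators_noncommutative[OF assms(1)] .
    ultimately have "\<not> functional_commutant_property ?X ?N ?T"
      unfolding functional_commutant_property_def
      using algebra_isomorphism_commutative[of _ _ "bounded_operators ?X ?N" _ A B] by auto
    then show ?thesis using False by blast
  qed
qed

end
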